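(* Let $d\ge 1$ and let $\beta>0$ be arbitrary. For every $\epsilon>0$ there is some $\delta>0$ such that for all translation-invariant probability measures $\mu$ on $\Omega=\{\pm1\}^{\mathbb Z^d}$ it holds that $$\sigma(\mu)\ \ge\ \delta\,\big(h(\mu)-\epsilon\big),$$ where $h(\mu)$ is the relative entropy density of $\mu$ with respect to the translation-invariant Ising Gibbs measures at inverse temperature $\beta$, and $\sigma(\mu)$ is the entropy production per site of the Ising Glauber dynamics at inverse temperature $\beta$.
   Context: Let $\Omega=\{\pm1\}^{\mathbb Z^d}$ with the product $\sigma$-algebra, and let $\mathcal P_\theta$ be the set of translation-invariant probability measures on $\Omega$. Write $x\sim y$ if $x,y$ are nearest neighbours in $\mathbb Z^d$. For $\omega\in\Omega$, $\omega_\Lambda$ is its restriction to $\Lambda\subset\mathbb Z^d$, $\Omega_\Lambda=\{\pm1\}^\Lambda$, and $\mu_\Lambda$ is the restriction of $\mu$ to the $\sigma$-algebra generated by the projection $\omega\mapsto\omega_\Lambda$ (equivalently, the marginal on $\Omega_\Lambda$). Let $\Lambda_n=[-n,n]^d\cap\mathbb Z^d$. Gibbs measures: for finite $\Lambda$ and $\eta\in\Omega$, $\gamma_{\Lambda,\eta}$ is the probability measure on $\Omega_\Lambda$ with weights proportional to $e^{-H_{\Lambda,\eta}(\omega_\Lambda)}$, where $$H_{\Lambda,\eta}(\omega_\Lambda)=-\frac\beta2\sum_{x,y\in\Lambda,\,x\sim y}\omega_x\omega_y-\beta\sum_{x\in\Lambda,\,y\in\Lambda^c,\,x\sim y}\omega_x\eta_y$$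 (the first sum is over ordered pairs). A probability measure $\nu$ on $\Omega$ is a Gibbs measure if for each finite $\Lambda$ the conditional law of $\omega_\Lambda$ given $\omega_{\Lambda^c}=\eta_{\Lambda^c}$ under $\nu$ is $\gamma_{\Lambda,\eta}$ for $\nu$-a.e. $\eta$. $\mathcal G_\theta(H)$ denotes the non-empty set of translation-invariant Gibbs measures. Relative entropy: $I(\mu\,|\,\nu)=\int\log\frac{\mathrm d\mu}{\mathrm d\nu}\,\mathrm d\mu$ if $\mu\ll\nu$ and $I(\mu\,|\,\nu)=\infty$ otherwise (also used for finite measures). Relative entropy density: for $\mu\in\mathcal P_\theta$, $$h(\mu)=h(\mu\,|\,\nu)=\lim_{n\to\infty}\frac{I(\mu_{\Lambda_n}\,|\,\nu_{\Lambda_n})}{|\Lambda_n|}\ge 0,\qquad \nu\in\mathcal G_\theta(H);$$ it is known that the limit exists and does not depend on the choice of $\nu\in\mathcal G_\theta(H)$. Flip rates: $c(x,\omega)=e^{-\beta\sum_{y\sim x}\omega_x\omega_y}$. Let $\mathrm{flip}_x:\Omega\to\Omega$ be the map that changes the sign of the spin at $x$ and leaves all other spins unchanged. Entropy production per site: for $\rho\in\mathcal P_\theta$, with $c(0,\cdot)\rho$ the measure with density $c(0,\cdot)$ with respect to $\rho$, $$\sigma(\rho)=\int\rho(\mathrm d\eta)\,c(0,\eta)\,\log\frac{\mathrm d(c(0,\cdot)\rho)}{\mathrm d\big((c(0,\cdot)\rho)\circ\mathrm{flip}_0^{-1}\big)}(\eta),$$ i.e. $\sigma(\rho)=I\big(c(0,\cdot)\rho\,\big|\,(c(0,\cdot)\rho)\circ\mathrm{flip}_0^{-1}\big)\in[0,\infty]$,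 equal to $\infty$ if absolute continuity fails. *)

theory Defs
  imports "HOL-Probability.Probability"
begin

section \<open>Spin configurations on the lattice\<close>

text \<open>The dimension of the lattice is the cardinality of the finite index type \<open>'d\<close>.\<close>

type_synonym 'd site = "int ^ 'd"

type_synonym 'd config = "'d site \<Rightarrow> real"

definition nbr :: "'d::finite site \<Rightarrow> 'd site \<Rightarrow> bool" where
  "nbr x y \<longleftrightarrow> (\<Sum>i\<in>UNIV. \<bar>x $ i - y $ i\<bar>) = 1"

definition lattice_box :: "nat \<Rightarrow> 'd::finite site set" where
  "lattice_box n = {x. \<forall>i. - int n \<le> x $ i \<and> x $ i \<le> int n}"

text \<open>The space of spin configurations on \<open>\<Lambda>\<close> with its product \<open>\<sigma>\<close>-algebra. Only the underlying
  measurable space is used. As usual for \<^const>\<open>PiM\<close>, configurations on \<open>\<Lambda>\<close> are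
  \<^const>\<open>undefined\<close> outside \<open>\<Lambda>\<close>.\<close>

definition spin_space :: "'d::finite site set \<Rightarrow> 'd config measure" where
  "spin_space \<Lambda> = (\<Pi>\<^sub>M x\<in>\<Lambda>. count_space {-1, 1})"

definition marginal :: "'d::finite site set \<Rightarrow> 'd config measure \<Rightarrow> 'd config measure" where
  "marginal \<Lambda> \<mu> = distr \<mu> (spin_space \<Lambda>) (\<lambda>\<omega>. restrict \<omega> \<Lambda>)"

definition tinv_measures :: "'d::finite config measure set" where
  "tinv_measures = {\<mu>. prob_space \<mu> \<and> sets \<mu> = sets (spin_space UNIV) \<and>
     (\<forall>a. distr \<mu> (spin_space UNIV) (\<lambda>\<omega> x. \<omega> (x + a)) = \<mu>)}"


section \<open>Ising Gibbs measures\<close>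

definition energy :: "real \<Rightarrow> 'd::finite site set \<Rightarrow> 'd config \<Rightarrow> 'd config \<Rightarrow> real" where
  "energy \<beta> \<Lambda> \<eta> \<zeta> =
     - (\<beta> / 2) * (\<Sum>(x, y) \<in> {(x, y). x \<in> \<Lambda> \<and> y \<in> \<Lambda> \<and> nbr x y}. \<zeta> x * \<zeta> y)
     - \<beta> * (\<Sum>(x, y) \<in> {(x, y). x \<in> \<Lambda> \<and> y \<notin> \<Lambda> \<and> nbr x y}. \<zeta> x * \<eta> y)"

definition finite_gibbs :: "real \<Rightarrow> 'd::finite site set \<Rightarrow> 'd config \<Rightarrow> 'd config measure" where
  "finite_gibbs \<beta> \<Lambda> \<eta> =
     point_measure (space (spin_space \<Lambda>))
       (\<lambda>\<zeta>. ennreal (exp (- energy \<beta> \<Lambda> \<eta> \<zeta>) /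
                     (\<Sum>\<xi>\<in>space (spin_space \<Lambda>). exp (- energy \<beta> \<Lambda> \<eta> \<xi>))))"

text \<open>The \<open>\<sigma>\<close>-algebra on full configurations generated by the spins outside \<open>\<Lambda>\<close>.\<close>

definition outside_algebra :: "'d::finite site set \<Rightarrow> 'd config measure" where
  "outside_algebra \<Lambda> =
     vimage_algebra (space (spin_space UNIV)) (\<lambda>\<omega>. restrict \<omega> (- \<Lambda>)) (spin_space (- \<Lambda>))"

definition gibbs_measure :: "real \<Rightarrow> 'd::finite config measure \<Rightarrow> bool" where
  "gibbs_measure \<beta> \<nu> \<longleftrightarrow> prob_space \<nu> \<and> sets \<nu> = sets (spin_space UNIV) \<and>
     (\<forall>\<Lambda>. finite \<Lambda> \<longrightarrow>
        (AE \<eta> in \<nu>. \<forall>A \<in> sets (spin_space \<Lambda>).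
           real_cond_exp \<nu> (outside_algebra \<Lambda>) (indicator {\<omega>. restrict \<omega> \<Lambda> \<in> A}) \<eta>
             = measure (finite_gibbs \<beta> \<Lambda> \<eta>) A))"

definition tinv_gibbs :: "real \<Rightarrow> 'd::finite config measure set" where
  "tinv_gibbs \<beta> = {\<nu> \<in> tinv_measures. gibbs_measure \<beta> \<nu>}"


section \<open>Relative entropy and relative entropy density\<close>

text \<open>Note the argument order of the library: \<open>KL_divergence b \<nu> \<mu>\<close> is the integral of
  \<open>log b (d\<mu>/d\<nu>)\<close> with respect to \<open>\<mu>\<close>, as a Bochner integral, which is \<open>0\<close> if the integrand is not
  integrable. For finite measures the negative part of the integrand is always integrable with
  respect to \<open>\<mu>\<close> (since \<open>t ln t \<ge> - 1 / exp 1\<close>), so non-integrability means that the integral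
  is \<open>\<infinity>\<close>.\<close>

definition rel_entropy :: "'a measure \<Rightarrow> 'a measure \<Rightarrow> ereal" where
  "rel_entropy \<mu> \<nu> =
     (if absolutely_continuous \<nu> \<mu> \<and> integrable \<mu> (entropy_density (exp 1) \<nu> \<mu>)
      then ereal (KL_divergence (exp 1) \<nu> \<mu>) else \<infinity>)"

definition rel_entropy_density :: "'d::finite config measure \<Rightarrow> 'd config measure \<Rightarrow> ereal" where
  "rel_entropy_density \<mu> \<nu> =
     lim (\<lambda>n. rel_entropy (marginal (lattice_box n) \<mu>) (marginal (lattice_box n) \<nu>)
              / ereal (real (card (lattice_box n :: 'd site set))))"


section \<open>Glauber dynamics and entropy production\<close>

definition flip_rate :: "real \<Rightarrow> 'd::finite site \<Rightarrow> 'd config \<Rightarrow> real" where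
  "flip_rate \<beta> x \<omega> = exp (- \<beta> * (\<Sum>y\<in>{y. nbr y x}. \<omega> x * \<omega> y))"

definition flip :: "'d::finite site \<Rightarrow> 'd config \<Rightarrow> 'd config" where
  "flip x \<omega> = fun_upd \<omega> x (- \<omega> x)"

definition entropy_production :: "real \<Rightarrow> 'd::finite config measure \<Rightarrow> ereal" where
  "entropy_production \<beta> \<rho> =
     (let c\<rho> = density \<rho> (\<lambda>\<omega>. ennreal (flip_rate \<beta> 0 \<omega>))
      in rel_entropy c\<rho> (distr c\<rho> (spin_space UNIV) (flip 0)))"

end

theory Submission
  imports Defs
begin

text \<open>Write \<open>C\<close> for a box. Given the spins outside \<open>C\<close>, the conditional law of the spins
in \<open>C\<close> under \<open>\<mu>\<close> is the Gibbs distribution as soon as it satisfies detailed balance for the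
single-spin flips in \<open>C\<close>, and \<open>\<sigma>(\<mu>)\<close> measures by how much detailed balance fails at one
site. The finite system in \<open>C\<close> has a Poincare inequality, so this has a quantitative form: the
expected relative entropy of the conditional law with respect to the Gibbs distribution is at most
\<open>K(C) \<sigma>(\<mu>)\<close>, with a constant \<open>K(C)\<close> independent of \<open>\<mu>\<close>
(\<open>relent_tile_le\<close>).

Fill a large box \<open>\<Lambda>\<close> by disjoint translates of \<open>C\<close> separated by corridors of sites.
By the chain rule for relative entropy, \<open>I(\<mu>\<^sub>\<Lambda> | \<nu>\<^sub>\<Lambda>)\<close> is at most the cost of
the corridors plus that of the translates of \<open>C\<close>. A corridor site costs at most a constant,
because the conditional probabilities of a Gibbs measure are bounded below. When the corridors are
known, a translate of \<open>C\<close> costs at most \<open>K(C) \<sigma>(\<mu>)\<close>, because its outer boundary lies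
in the corridors and the conditional law under \<open>\<nu>\<close> is then the Gibbs distribution. Division by
\<open>|\<Lambda>|\<close> bounds \<open>h(\<mu>)\<close> by a constant times the density of the corridors plus
\<open>K(C) \<sigma>(\<mu>)\<close> times the density of the translates (\<open>box_relent_le\<close>,
\<open>rel_entropy_density_le\<close>). Choosing \<open>C\<close> so large that the first term is below \<open>\<epsilon>\<close> proves
the theorem.

Compactness would not suffice here: measures with small entropy production are close to Gibbs measures
on local events, but \<open>h\<close> is only lower semicontinuous. What keeps \<open>h\<close> small is that the
conditional law in \<open>C\<close> is compared with the Gibbs distribution given all spins revealed before.

All entropies are finite sums over cylinder probabilities. Two facts connect them with the
measure-theoretic quantities. The entropy production dominates its restriction to every finite
window (\<open>entropy_production_ge_local_production\<close>). And the limit defining \<open>h\<close> exists: up to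
surface terms \<open>\<nu>\<close> is a product over disjoint regions, hence relative entropy is superadditive
up to surface terms (\<open>relent_superadditive\<close>, \<open>box_relent_density_convergent\<close>).\<close>

section \<open>Cylinder probabilities\<close>

definition configs :: "'d::finite site set \<Rightarrow> 'd config set" where
  "configs \<Lambda> = (\<Lambda> \<rightarrow>\<^sub>E {-1, 1})"

definition cylinder :: "'d::finite site set \<Rightarrow> 'd config \<Rightarrow> 'd config set" where
  "cylinder \<Lambda> \<zeta> = {\<omega> \<in> configs UNIV. \<forall>x\<in>\<Lambda>. \<omega> x = \<zeta> x}"

definition cyl :: "'d::finite config measure \<Rightarrow> 'd site set \<Rightarrow> 'd config \<Rightarrow> real" where
  "cyl \<mu> \<Lambda> \<zeta> = measure \<mu> (cylinder \<Lambda> \<zeta>)"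

lemma space_spin_space: "space (spin_space \<Lambda>) = configs \<Lambda>"
  by (simp add: spin_space_def configs_def space_PiM)

lemma finite_configs [simp]: "finite \<Lambda> \<Longrightarrow> finite (configs \<Lambda>)"
  by (simp add: configs_def finite_PiE)

lemma configs_nonempty: "configs \<Lambda> \<noteq> {}"
  by (simp add: configs_def PiE_eq_empty_iff)

lemma configs_abs: "\<zeta> \<in> configs \<Lambda> \<Longrightarrow> x \<in> \<Lambda> \<Longrightarrow> \<bar>\<zeta> x\<bar> = 1"
  by (force simp: configs_def PiE_def Pi_def)

lemma configs_spin: "\<zeta> \<in> configs \<Lambda> \<Longrightarrow> x \<in> \<Lambda> \<Longrightarrow> \<zeta> x = -1 \<or> \<zeta> x = 1"
  by (force simp: configs_def PiE_def Pi_def)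

lemma override_on_configs:
  "\<xi> \<in> configs R \<Longrightarrow> \<eta> \<in> configs T \<Longrightarrow> override_on \<xi> \<eta> T \<in> configs (R \<union> T)"
  by (auto simp: configs_def override_on_def PiE_iff extensional_def)

lemma restrict_configs: "\<omega> \<in> configs \<Lambda>' \<Longrightarrow> \<Lambda> \<subseteq> \<Lambda>' \<Longrightarrow> restrict \<omega> \<Lambda> \<in> configs \<Lambda>"
  by (auto simp: configs_def PiE_iff)

lemma restrict_override: "\<zeta> \<in> configs (R \<union> T) \<Longrightarrow> override_on (restrict \<zeta> R) (restrict \<zeta> T) T = \<zeta>"
  by (auto simp: configs_def PiE_iff extensional_def fun_eq_iff override_on_def)

text \<open>\<open>override_on \<xi> \<eta> T\<close> glues a configuration \<open>\<eta>\<close> on \<open>T\<close> into \<open>\<xi>\<close>. In the resulting double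
sum the inner sum runs over the spins in \<open>T\<close> for a fixed configuration in \<open>R\<close>, which is the
form in which conditioning on \<open>R\<close> appears below.\<close>

lemma sum_configs_Un:
  fixes G :: "'d::finite config \<Rightarrow> 'b::comm_monoid_add"
  assumes "R \<inter> T = {}"
  shows "(\<Sum>\<zeta>\<in>configs (R \<union> T). G \<zeta>) = (\<Sum>\<xi>\<in>configs R. \<Sum>\<eta>\<in>configs T. G (override_on \<xi> \<eta> T))"
proof -
  have "(\<Sum>(\<xi>, \<eta>)\<in>configs R \<times> configs T. G (override_on \<xi> \<eta> T)) = (\<Sum>\<zeta>\<in>configs (R \<union> T). G \<zeta>)"
  proof (rule sum.reindex_bij_witness[where i = "\<lambda>\<zeta>. (restrict \<zeta> R, restrict \<zeta> T)"
        and j = "\<lambda>(\<xi>, \<eta>). override_on \<xi> \<eta> T"], goal_cases)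
    case (1 a)
    with assms show ?case
      by (force simp: configs_def override_on_def PiE_iff extensional_def fun_eq_iff)
  next
    case (2 a)
    then show ?case using override_on_configs by auto
  next
    case (3 b)
    then show ?case
      by (auto simp: configs_def override_on_def PiE_iff extensional_def fun_eq_iff)
  next
    case (4 b)
    then show ?case by (auto intro: restrict_configs)
  qed auto
  then show ?thesis by (simp add: sum.cartesian_product)
qed

lemma cylinder_cong: "(\<And>x. x \<in> \<Lambda> \<Longrightarrow> \<zeta> x = \<zeta>' x) \<Longrightarrow> cylinder \<Lambda> \<zeta> = cylinder \<Lambda> \<zeta>'"
  by (auto simp: cylinder_def)

lemma cyl_cong: "(\<And>x. x \<in> \<Lambda> \<Longrightarrow> \<zeta> x = \<zeta>' x) \<Longrightarrow> cyl \<mu> \<Lambda> \<zeta> = cyl \<mu> \<Lambda> \<zeta>'"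
  unfolding cyl_def using cylinder_cong by metis

lemma cylinder_Un: "R \<inter> T = {} \<Longrightarrow>
    cylinder (R \<union> T) (override_on \<xi> \<eta> T) = cylinder R \<xi> \<inter> cylinder T \<eta>"
  by (auto simp: cylinder_def override_on_def)

lemma cyl_override_left: "R \<inter> T = {} \<Longrightarrow> cyl \<mu> R (override_on \<xi> \<eta> T) = cyl \<mu> R \<xi>"
  by (rule cyl_cong) (auto simp: override_on_def)

lemma cyl_override_right: "cyl \<mu> T (override_on \<xi> \<eta> T) = cyl \<mu> T \<eta>"
  by (rule cyl_cong) (auto simp: override_on_def)

lemma cylinder_disjoint: "disjoint_family_on (cylinder \<Lambda>) (configs \<Lambda>)"
  unfolding disjoint_family_on_def
proof (intro ballI impI)
  fix \<zeta> \<zeta>' :: "'a config" assume "\<zeta> \<in> configs \<Lambda>" "\<zeta>' \<in> configs \<Lambda>" "\<zeta> \<noteq> \<zeta>'"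
  then obtain x where "x \<in> \<Lambda>" "\<zeta> x \<noteq> \<zeta>' x"
    by (metis configs_def PiE_ext)
  then show "cylinder \<Lambda> \<zeta> \<inter> cylinder \<Lambda> \<zeta>' = {}" by (force simp: cylinder_def)
qed

lemma cylinder_UN: "(\<Union>\<zeta>\<in>configs \<Lambda>. cylinder \<Lambda> \<zeta>) = configs UNIV"
proof -
  have "\<omega> \<in> (\<Union>\<zeta>\<in>configs \<Lambda>. cylinder \<Lambda> \<zeta>)" if "\<omega> \<in> configs UNIV" for \<omega> :: "'a config"
    using that by (intro UN_I[of "restrict \<omega> \<Lambda>"]) (auto simp: cylinder_def intro: restrict_configs)
  then show ?thesis by (auto simp: cylinder_def)
qed

lemma finite_spin_event_measurable:
  assumes "finite R" "R \<subseteq> \<Lambda>"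
  shows "{\<omega> \<in> configs \<Lambda>. \<forall>x\<in>R. \<omega> x = \<xi> x} \<in> sets (spin_space \<Lambda>)"
proof -
  have "{\<omega> \<in> space (spin_space \<Lambda>). \<omega> x = \<xi> x} \<in> sets (spin_space \<Lambda>)" if x: "x \<in> R" for x
  proof -
    have "(\<lambda>\<omega>. \<omega> x) \<in> spin_space \<Lambda> \<rightarrow>\<^sub>M count_space {-1, 1::real}"
      unfolding spin_space_def using assms x by (intro measurable_component_singleton) auto
    then have "(\<lambda>\<omega>. \<omega> x) -` ({\<xi> x} \<inter> {-1,1}) \<inter> space (spin_space \<Lambda>) \<in> sets (spin_space \<Lambda>)"
      by (rule measurable_sets) auto
    moreover have "(\<lambda>\<omega>. \<omega> x) -` ({\<xi> x} \<inter> {-1,1}) \<inter> space (spin_space \<Lambda>)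
        = {\<omega> \<in> space (spin_space \<Lambda>). \<omega> x = \<xi> x}"
      using assms x by (auto simp: space_spin_space dest: configs_spin[of _ \<Lambda>])
    ultimately show ?thesis by simp
  qed
  then have "{\<omega> \<in> space (spin_space \<Lambda>). \<forall>x\<in>R. \<omega> x = \<xi> x} \<in> sets (spin_space \<Lambda>)"
    using assms by (intro sets.sets_Collect_finite_All) auto
  then show ?thesis by (simp add: space_spin_space)
qed

lemma cylinder_measurable: "finite \<Lambda> \<Longrightarrow> cylinder \<Lambda> \<zeta> \<in> sets (spin_space UNIV)"
  unfolding cylinder_def by (rule finite_spin_event_measurable) auto

locale spin_law = prob_space \<mu> for \<mu> :: "'d::finite config measure" +
  assumes sets_spin [measurable_cong]: "sets \<mu> = sets (spin_space UNIV)"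
begin

lemma space_spin: "space \<mu> = configs UNIV"
  using sets_eq_imp_space_eq[OF sets_spin] by (simp add: space_spin_space)

lemma cylinder_sets [measurable]: "finite \<Lambda> \<Longrightarrow> cylinder \<Lambda> \<zeta> \<in> sets \<mu>"
  using cylinder_measurable sets_spin by blast

lemma cyl_marginal:
  assumes "finite R" "finite T" "R \<inter> T = {}"
  shows "(\<Sum>\<eta>\<in>configs T. cyl \<mu> (R \<union> T) (override_on \<xi> \<eta> T)) = cyl \<mu> R \<xi>"
proof -
  have "(\<Sum>\<eta>\<in>configs T. cyl \<mu> (R \<union> T) (override_on \<xi> \<eta> T))
      = (\<Sum>\<eta>\<in>configs T. measure \<mu> (cylinder R \<xi> \<inter> cylinder T \<eta>))"
    using assms by (simp add: cyl_def cylinder_Un)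
  also have "\<dots> = measure \<mu> (\<Union>\<eta>\<in>configs T. cylinder R \<xi> \<inter> cylinder T \<eta>)"
    using assms cylinder_disjoint[of T]
    by (intro finite_measure_finite_Union[symmetric])
       (auto simp: disjoint_family_on_def intro!: sets.Int cylinder_sets)
  also have "(\<Union>\<eta>\<in>configs T. cylinder R \<xi> \<inter> cylinder T \<eta>) = cylinder R \<xi>"
    using cylinder_UN[of T] by (auto simp: cylinder_def)
  finally show ?thesis by (simp add: cyl_def)
qed

lemma cyl_sum:
  assumes "finite \<Lambda>"
  shows "(\<Sum>\<zeta>\<in>configs \<Lambda>. cyl \<mu> \<Lambda> \<zeta>) = 1"
proof -
  have "(\<Sum>\<zeta>\<in>configs \<Lambda>. cyl \<mu> \<Lambda> \<zeta>) = measure \<mu> (\<Union>\<zeta>\<in>configs \<Lambda>. cylinder \<Lambda> \<zeta>)"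
    using assms unfolding cyl_def
    by (intro finite_measure_finite_Union[symmetric] cylinder_disjoint)
       (auto intro!: cylinder_sets)
  then show ?thesis by (simp add: cylinder_UN prob_space flip: space_spin)
qed

lemma cyl_nonneg: "0 \<le> cyl \<mu> \<Lambda> \<zeta>"
  by (simp add: cyl_def)

lemma sum_cyl_Un:
  assumes "finite R" "finite T" "R \<inter> T = {}"
    and "\<And>\<xi> \<eta>. F (override_on \<xi> \<eta> T) = F \<xi>"
  shows "(\<Sum>\<zeta>\<in>configs (R \<union> T). cyl \<mu> (R \<union> T) \<zeta> * F \<zeta>) = (\<Sum>\<xi>\<in>configs R. cyl \<mu> R \<xi> * F \<xi>)"
  using assms by (simp add: sum_configs_Un cyl_marginal flip: sum_distrib_right)

lemma cyl_mono:
  assumes "finite R" "R \<subseteq> W"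
  shows "cyl \<mu> W \<zeta> \<le> cyl \<mu> R \<zeta>"
  unfolding cyl_def using assms by (intro finite_measure_mono cylinder_sets) (auto simp: cylinder_def)

end

section \<open>The DLR equations on cylinder events\<close>

definition gibbs_weight :: "real \<Rightarrow> 'd::finite site set \<Rightarrow> 'd config \<Rightarrow> 'd config \<Rightarrow> real" where
  "gibbs_weight \<beta> T \<eta> \<zeta> =
     exp (- energy \<beta> T \<eta> \<zeta>) / (\<Sum>\<xi>\<in>configs T. exp (- energy \<beta> T \<eta> \<xi>))"

lemma outside_algebra_subalgebra:
  "subalgebra (spin_space UNIV) (outside_algebra T)"
proof -
  have "(\<lambda>\<omega>. restrict \<omega> (- T)) \<in> spin_space UNIV \<rightarrow>\<^sub>M spin_space (- T)"
    unfolding spin_space_def by (rule measurable_restrict_subset) auto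
  moreover have "space (outside_algebra T) = space (spin_space UNIV)"
    by (simp add: outside_algebra_def)
  ultimately show ?thesis
    by (auto simp: subalgebra_def outside_algebra_def sets_vimage_algebra2 space_spin_space
      restrict_configs dest: measurable_sets)
qed

lemma cylinder_outside_algebra:
  assumes "finite R" "R \<inter> T = {}"
  shows "cylinder R \<xi> \<in> sets (outside_algebra T)"
proof -
  have R: "R \<subseteq> - T" using assms by auto
  let ?A = "{\<omega> \<in> configs (- T). \<forall>x\<in>R. \<omega> x = \<xi> x}"
  have "(\<lambda>\<omega>. restrict \<omega> (- T)) -` ?A \<inter> space (spin_space UNIV) \<in> sets (outside_algebra T)"
    unfolding outside_algebra_def using assms(1) R
    by (intro in_vimage_algebra finite_spin_event_measurable)
  also have "(\<lambda>\<omega>. restrict \<omega> (- T)) -` ?A \<inter> space (spin_space UNIV) = cylinder R \<xi>"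
    using R by (auto simp: cylinder_def space_spin_space restrict_configs)
  finally show ?thesis .
qed

lemma gibbs_partition_pos:
  assumes "finite T"
  shows "(\<Sum>\<xi>\<in>configs T. exp (- energy \<beta> T \<eta> \<xi>)) > 0"
  using assms configs_nonempty by (intro sum_pos) auto

lemma gibbs_weight_pos: "finite T \<Longrightarrow> gibbs_weight \<beta> T \<eta> \<zeta> > 0"
  by (simp add: gibbs_weight_def gibbs_partition_pos)

lemma gibbs_weight_sum:
  assumes "finite T"
  shows "(\<Sum>\<zeta>\<in>configs T. gibbs_weight \<beta> T \<eta> \<zeta>) = 1"
  using gibbs_partition_pos[OF assms, of \<beta> \<eta>]
  by (simp add: gibbs_weight_def flip: sum_divide_distrib)

lemma measure_finite_gibbs_singleton:
  assumes "finite T" "\<zeta> \<in> configs T"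
  shows "measure (finite_gibbs \<beta> T \<eta>) {\<zeta>} = gibbs_weight \<beta> T \<eta> \<zeta>"
proof -
  have "emeasure (finite_gibbs \<beta> T \<eta>) {\<zeta>} = ennreal (gibbs_weight \<beta> T \<eta> \<zeta>)"
    unfolding finite_gibbs_def space_spin_space
    using assms by (subst emeasure_point_measure_finite) (auto simp: gibbs_weight_def)
  then show ?thesis
    using gibbs_weight_pos[OF assms(1)] by (simp add: measure_def less_imp_le)
qed

text \<open>Integrated over a cylinder event outside \<open>T\<close>, the conditional expectation in the definition of a
Gibbs measure turns the probability of seeing \<open>\<eta>\<close> on \<open>T\<close> into an average of Gibbs weights over the
boundary conditions \<open>\<omega>\<close> that agree with \<open>\<xi>\<close>. Bounds that are uniform in \<open>\<omega>\<close> survive the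
averaging, and only such bounds are used later.\<close>

lemma gibbs_cyl_bounds:
  fixes T :: "'d::finite site set"
  assumes "gibbs_measure \<beta> \<nu>" "finite R" "finite T" "R \<inter> T = {}" "\<eta> \<in> configs T"
    and bounds: "\<And>\<omega>. \<omega> \<in> cylinder R \<xi> \<Longrightarrow> a \<le> gibbs_weight \<beta> T \<omega> \<eta> \<and> gibbs_weight \<beta> T \<omega> \<eta> \<le> b"
  shows "a * cyl \<nu> R \<xi> \<le> cyl \<nu> (R \<union> T) (override_on \<xi> \<eta> T)"
    and "cyl \<nu> (R \<union> T) (override_on \<xi> \<eta> T) \<le> b * cyl \<nu> R \<xi>"
proof -
  interpret spin_law \<nu>
    using assms(1) by (simp add: gibbs_measure_def spin_law_def spin_law_axioms_def)
  interpret finite_measure_subalgebra \<nu> "outside_algebra T"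
    using outside_algebra_subalgebra[of T] sets_spin sets_eq_imp_space_eq[OF sets_spin]
    by unfold_locales (auto simp: subalgebra_def)
  define f :: "'d config \<Rightarrow> real" where "f = indicator {\<omega>. restrict \<omega> T \<in> {\<eta>}}"
  have T: "cylinder T \<eta> = {\<omega>. restrict \<omega> T \<in> {\<eta>}} \<inter> space \<nu>"
    using assms(5) by (auto simp: cylinder_def space_spin configs_def PiE_iff extensional_def fun_eq_iff)
  have [measurable]: "f \<in> borel_measurable \<nu>"
  proof -
    have "f \<in> borel_measurable \<nu> \<longleftrightarrow> (indicator (cylinder T \<eta>) :: 'd config \<Rightarrow> real) \<in> borel_measurable \<nu>"
      by (rule measurable_cong) (auto simp: f_def T indicator_def)
    then show ?thesis using assms(3) by (simp add: cylinder_sets)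
  qed
  have "norm (f \<omega>) \<le> 1" for \<omega>
    by (simp add: f_def indicator_def)
  then have f: "integrable \<nu> f"
    by (intro integrable_const_bound[where B = 1] AE_I2) auto
  have sing: "{\<eta>} \<in> sets (spin_space T)"
  proof -
    have "{\<eta>} = (\<Pi>\<^sub>E x\<in>T. {\<eta> x})"
      using assms(5) by (intro PiE_singleton[symmetric]) (auto simp: configs_def PiE_iff)
    also have "\<dots> \<in> sets (spin_space T)"
      unfolding spin_space_def using assms(3,5)
      by (intro sets_PiM_I_finite) (auto simp: configs_def PiE_iff)
    finally show ?thesis .
  qed
  have "AE \<omega> in \<nu>. \<forall>A \<in> sets (spin_space T).
      real_cond_exp \<nu> (outside_algebra T) (indicator {\<omega>. restrict \<omega> T \<in> A}) \<omega>
        = measure (finite_gibbs \<beta> T \<omega>) A"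
    using assms(1,3) by (simp add: gibbs_measure_def)
  then have AE: "AE \<omega> in \<nu>. real_cond_exp \<nu> (outside_algebra T) f \<omega> = gibbs_weight \<beta> T \<omega> \<eta>"
  proof eventually_elim
    case (elim \<omega>)
    from bspec[OF this sing] show ?case
      unfolding f_def measure_finite_gibbs_singleton[OF assms(3,5)] .
  qed
  have int: "integrable \<nu> (\<lambda>\<omega>. indicator (cylinder R \<xi>) \<omega> * real_cond_exp \<nu> (outside_algebra T) f \<omega>)"
    using integrable_mult_indicator[OF cylinder_sets real_cond_exp_int(1)] assms(2) f by simp
  have "cyl \<nu> (R \<union> T) (override_on \<xi> \<eta> T) = (\<integral>\<omega>. indicator (cylinder R \<xi> \<inter> cylinder T \<eta>) \<omega> \<partial>\<nu>)"
    using assms by (simp add: cyl_def cylinder_Un Int_absorb1 sets.sets_into_space)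
  also have "\<dots> = (\<integral>\<omega>\<in>cylinder R \<xi>. f \<omega> \<partial>\<nu>)"
    unfolding set_lebesgue_integral_def using T
    by (intro Bochner_Integration.integral_cong) (auto simp: f_def indicator_def)
  also have "\<dots> = (\<integral>\<omega>\<in>cylinder R \<xi>. real_cond_exp \<nu> (outside_algebra T) f \<omega> \<partial>\<nu>)"
    using assms f by (intro real_cond_exp_intA cylinder_outside_algebra)
  finally have eq: "cyl \<nu> (R \<union> T) (override_on \<xi> \<eta> T)
      = (\<integral>\<omega>. indicator (cylinder R \<xi>) \<omega> * real_cond_exp \<nu> (outside_algebra T) f \<omega> \<partial>\<nu>)"
    by (simp add: set_lebesgue_integral_def)
  have c: "c * cyl \<nu> R \<xi> = (\<integral>\<omega>. indicator (cylinder R \<xi>) \<omega> * c \<partial>\<nu>)" for c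
    using assms by (simp add: cyl_def Int_absorb1 sets.sets_into_space)
  have ic: "integrable \<nu> (\<lambda>\<omega>. indicator (cylinder R \<xi>) \<omega> * c)" for c :: real
    using integrable_mult_indicator[OF cylinder_sets[of R \<xi>], of "\<lambda>_. c"] assms(2) by simp
  from AE have AEa: "AE \<omega> in \<nu>. indicator (cylinder R \<xi>) \<omega> * a
      \<le> indicator (cylinder R \<xi>) \<omega> * real_cond_exp \<nu> (outside_algebra T) f \<omega>"
    by eventually_elim (use bounds in \<open>auto simp: indicator_def\<close>)
  from AE have AEb: "AE \<omega> in \<nu>. indicator (cylinder R \<xi>) \<omega> * real_cond_exp \<nu> (outside_algebra T) f \<omega>
      \<le> indicator (cylinder R \<xi>) \<omega> * b"
    by eventually_elim (use bounds in \<open>auto simp: indicator_def\<close>)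
  show "a * cyl \<nu> R \<xi> \<le> cyl \<nu> (R \<union> T) (override_on \<xi> \<eta> T)"
    unfolding eq c by (intro integral_mono_AE int ic AEa)
  show "cyl \<nu> (R \<union> T) (override_on \<xi> \<eta> T) \<le> b * cyl \<nu> R \<xi>"
    unfolding eq c by (intro integral_mono_AE int ic AEb)
qed

section \<open>Nearest neighbours, energy estimates and detailed balance\<close>

definition boundary_edges :: "'d::finite site set \<Rightarrow> ('d site \<times> 'd site) set" where
  "boundary_edges T = {(x, y). x \<in> T \<and> y \<notin> T \<and> nbr x y}"

lemma nbr_sym: "nbr x y \<longleftrightarrow> nbr y x"
  by (simp add: nbr_def abs_minus_commute)

lemma nbr_irrefl [simp]: "\<not> nbr x x"
  by (simp add: nbr_def)

lemma nbr_coord: "nbr x y \<Longrightarrow> \<bar>x $ i - y $ i\<bar> \<le> 1"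
  using member_le_sum[of i UNIV "\<lambda>i. \<bar>x $ i - y $ i\<bar>"] by (simp add: nbr_def)

lemma bij_betw_lattice_box:
  "bij_betw vec_nth (lattice_box n :: 'd::finite site set) (UNIV \<rightarrow>\<^sub>E {- int n..int n})"
  by (rule bij_betw_byWitness[where f' = vec_lambda]) (auto simp: lattice_box_def)

lemma finite_lattice_box [simp]: "finite (lattice_box n :: 'd::finite site set)"
  using bij_betw_finite[OF bij_betw_lattice_box[where 'd = 'd]] by (simp add: finite_PiE)

lemma card_lattice_box: "card (lattice_box n :: 'd::finite site set) = (2 * n + 1) ^ CARD('d)"
  using bij_betw_same_card[OF bij_betw_lattice_box[where 'd = 'd and n = n]]
  by (simp add: card_PiE nat_add_distrib nat_mult_distrib)

lemma finite_nbrs [simp]: "finite {y :: 'd::finite site. nbr y x}"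
proof -
  have "{y. nbr y x} \<subseteq> (\<lambda>z. z + x) ` lattice_box 1"
  proof
    fix y assume "y \<in> {y. nbr y x}"
    then have "\<bar>y $ i - x $ i\<bar> \<le> 1" for i using nbr_coord by auto
    then have "- 1 \<le> y $ i - x $ i \<and> y $ i - x $ i \<le> 1" for i
      using abs_le_D2[of "y $ i - x $ i" 1] abs_le_D1[of "y $ i - x $ i" 1] by fastforce
    then have "y - x \<in> lattice_box 1" by (simp add: lattice_box_def)
    then show "y \<in> (\<lambda>z. z + x) ` lattice_box 1"
      by (intro image_eqI[of _ _ "y - x"]) auto
  qed
  then show ?thesis by (rule finite_subset) simp
qed

lemma card_nbrs: "card {y :: 'd::finite site. nbr y x} = card {y :: 'd site. nbr y 0}"
proof -
  have "bij_betw (\<lambda>y. y + x) {y :: 'd site. nbr y 0} {y. nbr y x}"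
    by (rule bij_betw_byWitness[where f' = "\<lambda>y. y - x"])
       (auto simp: nbr_def)
  then show ?thesis by (rule bij_betw_same_card[symmetric])
qed

lemma
  fixes T :: "'d::finite site set"
  assumes "finite T"
  shows finite_edges [simp]: "finite {(x, y). x \<in> T \<and> nbr x y}"
    and card_edges: "card {(x, y). x \<in> T \<and> nbr x y} = card T * card {y :: 'd site. nbr y 0}"
proof -
  have "{(x, y). x \<in> T \<and> nbr x y} = (SIGMA x:T. {y. nbr y x})" by (auto simp: nbr_sym)
  moreover have "(\<Sum>x\<in>T. card {y. nbr y x}) = (\<Sum>x\<in>T. card {y :: 'd site. nbr y 0})"
    by (intro sum.cong card_nbrs refl)
  ultimately show "finite {(x, y). x \<in> T \<and> nbr x y}"
    and "card {(x, y). x \<in> T \<and> nbr x y} = card T * card {y :: 'd site. nbr y 0}"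
    using assms by simp_all
qed

lemma finite_boundary_edges [simp]: "finite T \<Longrightarrow> finite (boundary_edges T)"
  by (rule finite_subset[of _ "{(x, y). x \<in> T \<and> nbr x y}"]) (auto simp: boundary_edges_def)

lemma card_configs: "finite T \<Longrightarrow> card (configs T) = 2 ^ card T"
  by (simp add: configs_def card_PiE) (simp add: numeral_2_eq_2)

lemma abs_sum_edges_le:
  assumes "finite A" "\<And>x y. (x, y) \<in> A \<Longrightarrow> \<bar>f x * g y\<bar> \<le> (c::real)"
  shows "\<bar>\<Sum>(x, y)\<in>A. f x * g y\<bar> \<le> c * card A"
proof -
  have "\<bar>\<Sum>(x, y)\<in>A. f x * g y\<bar> \<le> (\<Sum>(x, y)\<in>A. \<bar>f x * g y\<bar>)"
    by (rule order.trans[OF sum_abs]) (simp add: case_prod_beta)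
  also have "\<dots> \<le> (\<Sum>p\<in>A. c)" using assms(2) by (intro sum_mono) auto
  finally show ?thesis by (simp add: mult.commute)
qed

lemma abs_energy_le:
  fixes T :: "'d::finite site set" and \<beta> :: real
  assumes "\<beta> \<ge> 0" "finite T" "\<eta> \<in> configs UNIV" "\<zeta> \<in> configs T"
  shows "\<bar>energy \<beta> T \<eta> \<zeta>\<bar> \<le> 2 * \<beta> * card T * card {y :: 'd site. nbr y 0}"
proof -
  let ?A = "{(x, y). x \<in> T \<and> y \<in> T \<and> nbr x y}" and ?B = "{(x, y). x \<in> T \<and> y \<notin> T \<and> nbr x y}"
  let ?E = "{(x, y). x \<in> T \<and> nbr x y}"
  have fin: "finite ?A" "finite ?B"
    using assms(2) by (auto intro: finite_subset[OF _ finite_edges[of T]])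
  have "card ?A \<le> card ?E" "card ?B \<le> card ?E"
    using assms(2) by (auto intro!: card_mono)
  then have c: "real (card ?A) \<le> card ?E" "real (card ?B) \<le> card ?E" by linarith+
  have "\<bar>\<Sum>(x, y)\<in>?A. \<zeta> x * \<zeta> y\<bar> \<le> 1 * real (card ?A)"
    using assms(4) fin by (intro abs_sum_edges_le) (auto simp: abs_mult configs_abs)
  moreover have "\<bar>\<Sum>(x, y)\<in>?B. \<zeta> x * \<eta> y\<bar> \<le> 1 * real (card ?B)"
    using assms(3,4) fin by (intro abs_sum_edges_le) (auto simp: abs_mult configs_abs)
  ultimately have *: "\<bar>\<Sum>(x, y)\<in>?A. \<zeta> x * \<zeta> y\<bar> \<le> card ?E" "\<bar>\<Sum>(x, y)\<in>?B. \<zeta> x * \<eta> y\<bar> \<le> card ?E"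
    using c by linarith+
  have "\<bar>energy \<beta> T \<eta> \<zeta>\<bar> \<le> \<beta> / 2 * \<bar>\<Sum>(x, y)\<in>?A. \<zeta> x * \<zeta> y\<bar> + \<beta> * \<bar>\<Sum>(x, y)\<in>?B. \<zeta> x * \<eta> y\<bar>"
    unfolding energy_def using assms(1)
    by (intro order.trans[OF abs_triangle_ineq4]) (simp add: abs_mult)
  also have "\<dots> \<le> \<beta> / 2 * card ?E + \<beta> * card ?E"
    using * assms(1) by (intro add_mono mult_left_mono) auto
  also have "\<dots> \<le> 2 * \<beta> * card ?E" using assms(1) by simp
  finally show ?thesis using assms(2) by (simp add: card_edges mult.assoc)
qed

lemma gibbs_weight_lower:
  fixes T :: "'d::finite site set" and \<beta> :: real
  assumes "\<beta> \<ge> 0" "finite T" "\<eta> \<in> configs UNIV" "\<zeta> \<in> configs T"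
  defines "B \<equiv> 2 * \<beta> * card T * card {y :: 'd site. nbr y 0}"
  shows "exp (- 2 * B) / 2 ^ card T \<le> gibbs_weight \<beta> T \<eta> \<zeta>"
proof -
  have E: "\<bar>energy \<beta> T \<eta> \<xi>\<bar> \<le> B" if "\<xi> \<in> configs T" for \<xi>
    unfolding B_def using assms that by (intro abs_energy_le) auto
  have "(\<Sum>\<xi>\<in>configs T. exp (- energy \<beta> T \<eta> \<xi>)) \<le> (\<Sum>\<xi>\<in>configs T. exp B)"
    using E by (intro sum_mono) (auto simp: abs_le_iff)
  also have "\<dots> = 2 ^ card T * exp B" using assms(2) by (simp add: card_configs)
  finally have Z: "(\<Sum>\<xi>\<in>configs T. exp (- energy \<beta> T \<eta> \<xi>)) \<le> 2 ^ card T * exp B" .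
  have "exp (- 2 * B) = exp (- B) * exp (- B)"
    by (simp flip: exp_add)
  then have "exp (- 2 * B) / 2 ^ card T = exp (- B) / (2 ^ card T * exp B)"
    by (simp add: exp_minus divide_inverse)
  also have "\<dots> \<le> gibbs_weight \<beta> T \<eta> \<zeta>"
    unfolding gibbs_weight_def using Z E[OF assms(4)] gibbs_partition_pos[OF assms(2)]
    by (intro frac_le) (auto simp: abs_le_iff)
  finally show ?thesis .
qed

text \<open>A change of the boundary condition changes the energy of every configuration by at most \<open>2 * \<beta>\<close> for
each boundary edge. This enters twice, through the Boltzmann factor and through the partition
function.\<close>

lemma gibbs_weight_compare:
  fixes T :: "'d::finite site set" and \<beta> :: real
  assumes "\<beta> \<ge> 0" "finite T" "\<eta> \<in> configs UNIV" "\<eta>' \<in> configs UNIV" "\<zeta> \<in> configs T"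
  shows "gibbs_weight \<beta> T \<eta> \<zeta> \<le> exp (4 * \<beta> * card (boundary_edges T)) * gibbs_weight \<beta> T \<eta>' \<zeta>"
proof -
  let ?c = "2 * \<beta> * card (boundary_edges T)"
  have E: "\<bar>energy \<beta> T \<eta> \<xi> - energy \<beta> T \<eta>' \<xi>\<bar> \<le> ?c" if "\<xi> \<in> configs T" for \<xi>
  proof -
    have "energy \<beta> T \<eta> \<xi> - energy \<beta> T \<eta>' \<xi>
        = - \<beta> * (\<Sum>(x, y)\<in>boundary_edges T. \<xi> x * (\<eta> y - \<eta>' y))"
      by (simp add: energy_def boundary_edges_def algebra_simps case_prod_beta sum_subtractf)
    moreover have "\<bar>\<Sum>(x, y)\<in>boundary_edges T. \<xi> x * (\<eta> y - \<eta>' y)\<bar> \<le> 2 * real (card (boundary_edges T))"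
    proof (rule abs_sum_edges_le)
      fix x y assume "(x, y) \<in> boundary_edges T"
      then have "\<bar>\<xi> x\<bar> = 1" using that by (auto simp: boundary_edges_def configs_abs)
      moreover have "\<bar>\<eta> y - \<eta>' y\<bar> \<le> 2"
        using configs_abs[OF assms(3), of y] configs_abs[OF assms(4), of y] by auto
      ultimately show "\<bar>\<xi> x * (\<eta> y - \<eta>' y)\<bar> \<le> 2" by (simp add: abs_mult)
    qed (use assms in auto)
    ultimately show ?thesis
      using mult_left_mono[OF _ assms(1)] assms(1) by (simp add: abs_mult mult.assoc mult.left_commute)
  qed
  have e1: "exp (- energy \<beta> T \<eta> \<zeta>) \<le> exp ?c * exp (- energy \<beta> T \<eta>' \<zeta>)"
    using E[OF assms(5)] by (simp add: abs_le_iff flip: exp_add)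
  have "exp (- energy \<beta> T \<eta>' \<xi>) \<le> exp ?c * exp (- energy \<beta> T \<eta> \<xi>)" if "\<xi> \<in> configs T" for \<xi>
    using E[OF that] by (simp add: abs_le_iff flip: exp_add)
  then have "(\<Sum>\<xi>\<in>configs T. exp (- energy \<beta> T \<eta>' \<xi>)) \<le> exp ?c * (\<Sum>\<xi>\<in>configs T. exp (- energy \<beta> T \<eta> \<xi>))"
    unfolding sum_distrib_left by (intro sum_mono)
  then have e2: "(\<Sum>\<xi>\<in>configs T. exp (- energy \<beta> T \<eta>' \<xi>)) / exp ?c \<le> (\<Sum>\<xi>\<in>configs T. exp (- energy \<beta> T \<eta> \<xi>))"
    by (simp add: field_simps)
  have "gibbs_weight \<beta> T \<eta> \<zeta>
      \<le> (exp ?c * exp (- energy \<beta> T \<eta>' \<zeta>)) / ((\<Sum>\<xi>\<in>configs T. exp (- energy \<beta> T \<eta>' \<xi>)) / exp ?c)"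
    unfolding gibbs_weight_def
    using gibbs_partition_pos[OF assms(2), of \<beta> \<eta>'] by (intro frac_le e1 e2) auto
  also have "\<dots> = exp (?c + ?c) * gibbs_weight \<beta> T \<eta>' \<zeta>"
    unfolding gibbs_weight_def exp_add by simp
  finally show ?thesis by (simp add: algebra_simps)
qed

lemma gibbs_weight_cong:
  assumes "\<And>x y. (x, y) \<in> boundary_edges T \<Longrightarrow> \<eta> y = \<eta>' y"
  shows "gibbs_weight \<beta> T \<eta> \<zeta> = gibbs_weight \<beta> T \<eta>' \<zeta>"
proof -
  have "energy \<beta> T \<eta> = energy \<beta> T \<eta>'"
    unfolding energy_def using assms by (intro ext arg_cong2[of _ _ _ _ minus] arg_cong2[of _ _ _ _ times] sum.cong)
      (auto simp: boundary_edges_def)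
  then show ?thesis by (simp add: gibbs_weight_def)
qed

lemma flip_apply: "flip x \<zeta> y = (if y = x then - \<zeta> x else \<zeta> y)"
  by (simp add: flip_def)

lemma flip_flip [simp]: "flip x (flip x \<zeta>) = \<zeta>"
  by (simp add: flip_def)

lemma flip_configs [intro]: "\<zeta> \<in> configs T \<Longrightarrow> x \<in> T \<Longrightarrow> flip x \<zeta> \<in> configs T"
  by (auto simp: configs_def flip_apply PiE_iff extensional_def)

text \<open>The energy counts every edge inside \<open>T\<close> as two ordered pairs with weight one half, so that a flip
changes each of the edges at \<open>x\<close> by the same amount, whether its other end lies in \<open>T\<close> or not.\<close>

lemma energy_flip:
  fixes T :: "'d::finite site set" and \<eta> \<zeta> :: "'d config"
  assumes "finite T" "x \<in> T"
  defines "\<omega> \<equiv> override_on \<eta> \<zeta> T"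
  shows "energy \<beta> T \<eta> (flip x \<zeta>) = energy \<beta> T \<eta> \<zeta> + 2 * \<beta> * (\<Sum>y\<in>{y. nbr y x}. \<omega> x * \<omega> y)"
proof -
  let ?A = "{(u, v). u \<in> T \<and> v \<in> T \<and> nbr u v}" and ?B = "{(u, v). u \<in> T \<and> v \<notin> T \<and> nbr u v}"
  let ?N = "{y. nbr y x}"
  have fin: "finite ?A" "finite ?B"
    using assms(1) by (auto intro: finite_subset[OF _ finite_edges[of T]])
  have "(\<Sum>(u, v)\<in>?A. flip x \<zeta> u * flip x \<zeta> v) - (\<Sum>(u, v)\<in>?A. \<zeta> u * \<zeta> v)
      = (\<Sum>p\<in>?A. (if fst p = x then - 2 * (\<zeta> x * \<zeta> (snd p)) else 0) + (if snd p = x then - 2 * (\<zeta> x * \<zeta> (fst p)) else 0))"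
    unfolding sum_subtractf[symmetric] by (intro sum.cong) (auto simp: flip_apply)
  also have "\<dots> = (\<Sum>p\<in>{p\<in>?A. fst p = x}. - 2 * (\<zeta> x * \<zeta> (snd p)))
      + (\<Sum>p\<in>{p\<in>?A. snd p = x}. - 2 * (\<zeta> x * \<zeta> (fst p)))"
    using fin by (simp add: sum.distrib flip: sum.inter_filter)
  also have "(\<Sum>p\<in>{p\<in>?A. fst p = x}. - 2 * (\<zeta> x * \<zeta> (snd p))) = (\<Sum>y\<in>?N \<inter> T. - 2 * (\<zeta> x * \<zeta> y))"
    using assms(2) by (intro sum.reindex_bij_witness[of _ "\<lambda>y. (x, y)" snd]) (auto simp: nbr_sym)
  also have "(\<Sum>p\<in>{p\<in>?A. snd p = x}. - 2 * (\<zeta> x * \<zeta> (fst p))) = (\<Sum>y\<in>?N \<inter> T. - 2 * (\<zeta> x * \<zeta> y))"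
    using assms(2) by (intro sum.reindex_bij_witness[of _ "\<lambda>y. (y, x)" fst]) (auto simp: nbr_sym)
  finally have A: "(\<Sum>(u, v)\<in>?A. flip x \<zeta> u * flip x \<zeta> v)
      = (\<Sum>(u, v)\<in>?A. \<zeta> u * \<zeta> v) - 4 * (\<Sum>y\<in>?N \<inter> T. \<zeta> x * \<zeta> y)"
    by (simp add: sum_distrib_left sum_negf flip: sum_distrib_left)
  have "(\<Sum>(u, v)\<in>?B. flip x \<zeta> u * \<eta> v) - (\<Sum>(u, v)\<in>?B. \<zeta> u * \<eta> v)
      = (\<Sum>p\<in>?B. (if fst p = x then - 2 * (\<zeta> x * \<eta> (snd p)) else 0))"
    unfolding sum_subtractf[symmetric] by (intro sum.cong) (auto simp: flip_apply)
  also have "\<dots> = (\<Sum>p\<in>{p\<in>?B. fst p = x}. - 2 * (\<zeta> x * \<eta> (snd p)))"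
    using fin by (simp flip: sum.inter_filter)
  also have "\<dots> = (\<Sum>y\<in>?N - T. - 2 * (\<zeta> x * \<eta> y))"
    using assms(2) by (intro sum.reindex_bij_witness[of _ "\<lambda>y. (x, y)" snd]) (auto simp: nbr_sym)
  finally have B: "(\<Sum>(u, v)\<in>?B. flip x \<zeta> u * \<eta> v)
      = (\<Sum>(u, v)\<in>?B. \<zeta> u * \<eta> v) - 2 * (\<Sum>y\<in>?N - T. \<zeta> x * \<eta> y)"
    by (simp add: sum_distrib_left sum_negf flip: sum_distrib_left)
  have "(\<Sum>y\<in>?N. \<omega> x * \<omega> y) = (\<Sum>y\<in>?N \<inter> T. \<omega> x * \<omega> y) + (\<Sum>y\<in>?N - T. \<omega> x * \<omega> y)"
    by (subst sum.union_disjoint[symmetric]) (auto intro: sum.cong)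
  also have "\<dots> = (\<Sum>y\<in>?N \<inter> T. \<zeta> x * \<zeta> y) + (\<Sum>y\<in>?N - T. \<zeta> x * \<eta> y)"
    using assms(2) by (intro arg_cong2[of _ _ _ _ plus] sum.cong) (auto simp: \<omega>_def)
  finally show ?thesis unfolding energy_def A B by (simp add: algebra_simps)
qed

lemma flip_rate_flip:
  "flip_rate \<beta> x (flip x \<omega>) = exp (\<beta> * (\<Sum>y\<in>{y. nbr y x}. \<omega> x * \<omega> y))"
proof -
  have "(\<Sum>y\<in>{y. nbr y x}. flip x \<omega> x * flip x \<omega> y) = (\<Sum>y\<in>{y. nbr y x}. - (\<omega> x * \<omega> y))"
    by (intro sum.cong) (auto simp: flip_apply)
  then show ?thesis by (simp add: flip_rate_def sum_negf)
qed

text \<open>The flip rate is the exponential of minus half of the energy difference caused by the flip.\<close>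

lemma detailed_balance:
  assumes "finite T" "x \<in> T"
  shows "flip_rate \<beta> x (override_on \<eta> (flip x \<zeta>) T) * gibbs_weight \<beta> T \<eta> (flip x \<zeta>)
       = flip_rate \<beta> x (override_on \<eta> \<zeta> T) * gibbs_weight \<beta> T \<eta> \<zeta>"
proof -
  have "override_on \<eta> (flip x \<zeta>) T = flip x (override_on \<eta> \<zeta> T)"
    using assms(2) by (auto simp: override_on_def flip_apply)
  then have "flip_rate \<beta> x (override_on \<eta> (flip x \<zeta>) T) * exp (- energy \<beta> T \<eta> (flip x \<zeta>))
      = flip_rate \<beta> x (override_on \<eta> \<zeta> T) * exp (- energy \<beta> T \<eta> \<zeta>)"
    unfolding energy_flip[OF assms]
    by (simp only: flip_rate_flip) (simp add: flip_rate_def flip: exp_add)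
  then show ?thesis
    unfolding gibbs_weight_def by simp
qed

lemma flip_rate_bounds:
  fixes x :: "'d::finite site" and \<beta> :: real
  assumes "\<beta> \<ge> 0" "\<zeta> \<in> configs W" "x \<in> W" "{y. nbr y x} \<subseteq> W"
  defines "D \<equiv> card {y :: 'd site. nbr y 0}"
  shows "exp (- \<beta> * D) \<le> flip_rate \<beta> x \<zeta>" "flip_rate \<beta> x \<zeta> \<le> exp (\<beta> * D)"
proof -
  have "\<bar>\<Sum>y\<in>{y. nbr y x}. \<zeta> x * \<zeta> y\<bar> \<le> (\<Sum>y\<in>{y. nbr y x}. 1)"
    using assms by (intro order.trans[OF sum_abs] sum_mono) (auto simp: abs_mult configs_abs)
  then have "\<bar>\<beta> * (\<Sum>y\<in>{y. nbr y x}. \<zeta> x * \<zeta> y)\<bar> \<le> \<beta> * D"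
    using assms(1) unfolding abs_mult D_def card_nbrs[of x, symmetric]
    by (intro mult_mono) auto
  then show "exp (- \<beta> * D) \<le> flip_rate \<beta> x \<zeta>" "flip_rate \<beta> x \<zeta> \<le> exp (\<beta> * D)"
    by (auto simp: flip_rate_def abs_le_iff)
qed

section \<open>Conditional probabilities of a Gibbs measure\<close>

lemma gibbs_cyl_boundary:
  assumes "gibbs_measure \<beta> \<nu>" "finite R" "finite T" "R \<inter> T = {}" "\<eta> \<in> configs T"
    and "\<And>x y. (x, y) \<in> boundary_edges T \<Longrightarrow> y \<in> R"
  shows "cyl \<nu> (R \<union> T) (override_on \<xi> \<eta> T) = gibbs_weight \<beta> T \<xi> \<eta> * cyl \<nu> R \<xi>"
proof -
  have "gibbs_weight \<beta> T \<omega> \<eta> = gibbs_weight \<beta> T \<xi> \<eta>" if "\<omega> \<in> cylinder R \<xi>" for \<omega>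
    using that assms(6) by (intro gibbs_weight_cong) (auto simp: cylinder_def)
  then show ?thesis
    using gibbs_cyl_bounds[OF assms(1-5), of \<xi> "gibbs_weight \<beta> T \<xi> \<eta>" "gibbs_weight \<beta> T \<xi> \<eta>"]
    by (intro antisym) auto
qed

text \<open>A lower bound for the probability that a Gibbs distribution on \<open>k\<close> sites gives to a configuration:
numerator and partition function are both estimated by the largest possible energy. The bounds that depend on the dimension only
through the type take that type as an argument.\<close>

definition weight_bound :: "'d::finite itself \<Rightarrow> real \<Rightarrow> nat \<Rightarrow> real" where
  "weight_bound _ \<beta> k = exp (- 4 * \<beta> * k * card {y :: 'd site. nbr y 0}) / 2 ^ k"

text \<open>Minus the logarithm of the lower bound on the conditional probability of a single spin. It bounds the
relative entropy that one additional site can contribute.\<close>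

definition site_cost :: "'d::finite itself \<Rightarrow> real \<Rightarrow> real" where
  "site_cost _ \<beta> = - ln (weight_bound TYPE('d) \<beta> 1)"

definition rate_bound :: "'d::finite itself \<Rightarrow> real \<Rightarrow> real" where
  "rate_bound _ \<beta> = exp (\<beta> * card {y :: 'd site. nbr y 0})"

lemma weight_bound_pos: "weight_bound TYPE('d::finite) \<beta> k > 0"
  by (simp add: weight_bound_def)

lemma gibbs_weight_ge_weight_bound:
  fixes T :: "'d::finite site set"
  assumes "\<beta> \<ge> 0" "finite T" "\<eta> \<in> configs UNIV" "\<zeta> \<in> configs T"
  shows "weight_bound TYPE('d) \<beta> (card T) \<le> gibbs_weight \<beta> T \<eta> \<zeta>"
  using gibbs_weight_lower[OF assms] by (simp add: weight_bound_def mult.assoc)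

lemma gibbs_cyl_ge:
  fixes T :: "'d::finite site set"
  assumes "\<beta> \<ge> 0" "gibbs_measure \<beta> \<nu>" "finite R" "finite T" "R \<inter> T = {}" "\<eta> \<in> configs T"
  shows "weight_bound TYPE('d) \<beta> (card T) * cyl \<nu> R \<xi> \<le> cyl \<nu> (R \<union> T) (override_on \<xi> \<eta> T)"
proof (rule gibbs_cyl_bounds(1)[OF assms(2-6), where b = 1])
  fix \<omega> assume "\<omega> \<in> cylinder R \<xi>"
  then have "\<omega> \<in> configs UNIV" by (simp add: cylinder_def)
  moreover have "gibbs_weight \<beta> T \<omega> \<eta> \<le> (\<Sum>\<eta>\<in>configs T. gibbs_weight \<beta> T \<omega> \<eta>)"
    using assms gibbs_weight_pos[OF assms(4)] by (intro member_le_sum) (auto intro: less_imp_le)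
  ultimately show "weight_bound TYPE('d) \<beta> (card T) \<le> gibbs_weight \<beta> T \<omega> \<eta> \<and> gibbs_weight \<beta> T \<omega> \<eta> \<le> 1"
    using assms gibbs_weight_ge_weight_bound by (auto simp: gibbs_weight_sum)
qed

text \<open>Both sides are comparable to the probability of \<open>\<xi>\<close> times a Gibbs weight on \<open>T\<close> with an arbitrary
fixed boundary condition, each up to the factor of \<open>gibbs_weight_compare\<close>.\<close>

lemma gibbs_quasi_product:
  fixes T :: "'d::finite site set"
  assumes "\<beta> \<ge> 0" "gibbs_measure \<beta> \<nu>" "finite R" "finite T" "R \<inter> T = {}" "\<eta> \<in> configs T"
  shows "cyl \<nu> (R \<union> T) (override_on \<xi> \<eta> T)
    \<le> exp (8 * \<beta> * card (boundary_edges T)) * (cyl \<nu> R \<xi> * cyl \<nu> T \<eta>)"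
proof -
  let ?c = "exp (4 * \<beta> * card (boundary_edges T))"
  interpret spin_law \<nu>
    using assms(2) by (simp add: gibbs_measure_def spin_law_def spin_law_axioms_def)
  obtain \<omega>\<^sub>0 :: "'d config" where \<omega>\<^sub>0: "\<omega>\<^sub>0 \<in> configs UNIV" using configs_nonempty by blast
  define w where "w = gibbs_weight \<beta> T \<omega>\<^sub>0 \<eta>"
  have b: "w / ?c \<le> gibbs_weight \<beta> T \<omega> \<eta> \<and> gibbs_weight \<beta> T \<omega> \<eta> \<le> ?c * w" if "\<omega> \<in> configs UNIV" for \<omega>
    unfolding w_def
    using gibbs_weight_compare[OF assms(1,4) that \<omega>\<^sub>0 assms(6)]
      gibbs_weight_compare[OF assms(1,4) \<omega>\<^sub>0 that assms(6)] by (simp add: field_simps)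
  have "cyl \<nu> ({} \<union> T) (override_on \<xi> \<eta> T) \<ge> w / ?c * cyl \<nu> {} \<xi>"
    using b by (intro gibbs_cyl_bounds(1)[OF assms(2) _ assms(4) _ assms(6), where b = "?c * w"])
      (auto simp: cylinder_def)
  moreover have "cyl \<nu> {} \<xi> = 1"
    using prob_space by (simp add: cyl_def cylinder_def space_spin)
  ultimately have T: "w \<le> ?c * cyl \<nu> T \<eta>"
    by (simp add: field_simps cyl_override_right)
  have "cyl \<nu> (R \<union> T) (override_on \<xi> \<eta> T) \<le> ?c * w * cyl \<nu> R \<xi>"
    using b by (intro gibbs_cyl_bounds(2)[OF assms(2-6), where a = "w / ?c"]) (auto simp: cylinder_def)
  also have "\<dots> \<le> ?c * (?c * cyl \<nu> T \<eta>) * cyl \<nu> R \<xi>"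
    using T by (intro mult_right_mono mult_left_mono) (auto simp: cyl_nonneg)
  also have "\<dots> = (?c * ?c) * (cyl \<nu> R \<xi> * cyl \<nu> T \<eta>)" by simp
  also have "?c * ?c = exp (8 * \<beta> * card (boundary_edges T))"
    by (simp flip: exp_add)
  finally show ?thesis .
qed

section \<open>Relative entropy in finite volume\<close>

definition relent :: "'d::finite config measure \<Rightarrow> 'd config measure \<Rightarrow> 'd site set \<Rightarrow> real" where
  "relent \<mu> \<nu> \<Lambda> = (\<Sum>\<zeta>\<in>configs \<Lambda>. cyl \<mu> \<Lambda> \<zeta> * ln (cyl \<mu> \<Lambda> \<zeta> / cyl \<nu> \<Lambda> \<zeta>))"

text \<open>The tangent line inequality for the logarithm. Summed over the atoms of two measures it gives the
Gibbs inequality.\<close>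

lemma mult_ln_ge:
  fixes a b :: real
  assumes "a \<ge> 0" "b \<ge> 0" "a > 0 \<Longrightarrow> b > 0"
  shows "a * ln (a / b) \<ge> a - b"
proof (cases "a = 0")
  case False
  with assms have ab: "a > 0" "b > 0" by auto
  then have "ln (b / a) \<le> b / a - 1" by (intro ln_le_minus_one) simp
  then have "a * ln (b / a) \<le> a * (b / a - 1)" using ab by (intro mult_left_mono) auto
  also have "\<dots> = b - a" using ab by (simp add: field_simps)
  finally show ?thesis using ab by (simp add: ln_div algebra_simps)
qed (use assms in auto)

locale gibbs_pair = mu: spin_law \<mu> for \<mu> :: "'d::finite config measure" +
  fixes \<nu> :: "'d config measure" and \<beta> :: real
  assumes beta_pos: "\<beta> > 0" and gibbs: "gibbs_measure \<beta> \<nu>"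

sublocale gibbs_pair \<subseteq> nu: spin_law \<nu>
  using gibbs by (simp add: gibbs_measure_def spin_law_def spin_law_axioms_def)

context gibbs_pair
begin

lemma beta_nonneg: "\<beta> \<ge> 0" using beta_pos by simp

lemma nu_cyl_pos:
  assumes "finite \<Lambda>" "\<zeta> \<in> configs \<Lambda>"
  shows "cyl \<nu> \<Lambda> \<zeta> > 0"
proof -
  have "cyl \<nu> {} \<zeta> = 1"
    using nu.prob_space by (simp add: cyl_def cylinder_def nu.space_spin)
  then show ?thesis
    using gibbs_cyl_ge[OF beta_nonneg gibbs finite.emptyI assms(1) _ assms(2), of \<zeta>]
      weight_bound_pos[of \<beta> "card \<Lambda>", where 'd = 'd]
    by (simp add: cyl_override_right)
qed

lemma relent_nonneg:
  assumes "finite \<Lambda>"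
  shows "relent \<mu> \<nu> \<Lambda> \<ge> 0"
proof -
  have "relent \<mu> \<nu> \<Lambda> \<ge> (\<Sum>\<zeta>\<in>configs \<Lambda>. cyl \<mu> \<Lambda> \<zeta> - cyl \<nu> \<Lambda> \<zeta>)"
    unfolding relent_def using assms
    by (intro sum_mono mult_ln_ge) (auto simp: mu.cyl_nonneg nu.cyl_nonneg nu_cyl_pos)
  then show ?thesis using assms by (simp add: sum_subtractf mu.cyl_sum nu.cyl_sum)
qed

lemma relent_sum_Un:
  assumes "finite R" "finite T" "R \<inter> T = {}"
  shows "relent \<mu> \<nu> R = (\<Sum>\<zeta>\<in>configs (R \<union> T). cyl \<mu> (R \<union> T) \<zeta> * ln (cyl \<mu> R \<zeta> / cyl \<nu> R \<zeta>))"
  unfolding relent_def using assms by (subst mu.sum_cyl_Un) (auto simp: cyl_override_left)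

text \<open>With respect to a product measure, relative entropy is superadditive, because the difference is the
mutual information of the spins in \<open>R\<close> and in \<open>T\<close> under \<open>\<mu>\<close>. Replacing \<open>\<nu>\<close> on
\<open>R \<union> T\<close> by the product of its marginals costs a surface term.\<close>

lemma relent_superadditive:
  assumes "finite R" "finite T" "R \<inter> T = {}"
  shows "relent \<mu> \<nu> R + relent \<mu> \<nu> T - 8 * \<beta> * card (boundary_edges T) \<le> relent \<mu> \<nu> (R \<union> T)"
proof -
  let ?W = "R \<union> T" and ?c = "8 * \<beta> * card (boundary_edges T)"
  have "(\<Sum>\<zeta>\<in>configs ?W. cyl \<mu> R \<zeta> * cyl \<mu> T \<zeta>) = (\<Sum>\<xi>\<in>configs R. \<Sum>\<eta>\<in>configs T. cyl \<mu> R \<xi> * cyl \<mu> T \<eta>)"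
    using assms(3) by (simp add: sum_configs_Un cyl_override_left cyl_override_right)
  also have "\<dots> = 1" using assms by (simp add: mu.cyl_sum flip: sum_distrib_left)
  finally have prod: "(\<Sum>\<zeta>\<in>configs ?W. cyl \<mu> R \<zeta> * cyl \<mu> T \<zeta>) = 1" .
  have "(\<Sum>\<zeta>\<in>configs ?W. cyl \<mu> ?W \<zeta> - cyl \<mu> R \<zeta> * cyl \<mu> T \<zeta> - ?c * cyl \<mu> ?W \<zeta>)
      \<le> (\<Sum>\<zeta>\<in>configs ?W. cyl \<mu> ?W \<zeta> * ln (cyl \<mu> ?W \<zeta> / cyl \<nu> ?W \<zeta>)
          - cyl \<mu> ?W \<zeta> * ln (cyl \<mu> R \<zeta> / cyl \<nu> R \<zeta>) - cyl \<mu> ?W \<zeta> * ln (cyl \<mu> T \<zeta> / cyl \<nu> T \<zeta>))"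
  proof (rule sum_mono)
    fix \<zeta> assume \<zeta>: "\<zeta> \<in> configs ?W"
    let ?m = "cyl \<mu> ?W \<zeta>" and ?mR = "cyl \<mu> R \<zeta>" and ?mT = "cyl \<mu> T \<zeta>"
    let ?n = "cyl \<nu> ?W \<zeta>" and ?nR = "cyl \<nu> R \<zeta>" and ?nT = "cyl \<nu> T \<zeta>"
    show "?m - ?mR * ?mT - ?c * ?m \<le> ?m * ln (?m / ?n) - ?m * ln (?mR / ?nR) - ?m * ln (?mT / ?nT)"
    proof (cases "?m = 0")
      case True
      then show ?thesis by (simp add: mu.cyl_nonneg)
    next
      case False
      have le: "?m \<le> ?mR" "?m \<le> ?mT" using assms by (auto intro: mu.cyl_mono)
      with False have m: "?m > 0" "?mR > 0" "?mT > 0" using mu.cyl_nonneg[of ?W \<zeta>] by linarith+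
      have r: "restrict \<zeta> R \<in> configs R" "restrict \<zeta> T \<in> configs T"
        using \<zeta> by (auto intro: restrict_configs)
      have n: "?n > 0" "?nR > 0" "?nT > 0"
        using nu_cyl_pos[OF _ \<zeta>] nu_cyl_pos[OF _ r(1)] nu_cyl_pos[OF _ r(2)] assms
          cyl_cong[of R "restrict \<zeta> R" \<zeta> \<nu>] cyl_cong[of T "restrict \<zeta> T" \<zeta> \<nu>] by auto
      have "?n \<le> exp ?c * (?nR * ?nT)"
        using gibbs_quasi_product[OF beta_nonneg gibbs assms r(2), of "restrict \<zeta> R"]
          cyl_cong[of R "restrict \<zeta> R" \<zeta> \<nu>] cyl_cong[of T "restrict \<zeta> T" \<zeta> \<nu>]
        by (simp add: restrict_override[OF \<zeta>])
      then have "ln ?n \<le> ln (exp ?c * (?nR * ?nT))" using n by (subst ln_le_cancel_iff) auto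
      then have n': "ln ?n \<le> ?c + ln ?nR + ln ?nT" using n by (simp add: ln_mult)
      have "?m - ?mR * ?mT \<le> ?m * ln (?m / (?mR * ?mT))"
        using m by (intro mult_ln_ge) auto
      also have "\<dots> = ?m * (ln ?m - ln ?mR - ln ?mT)"
        using m by (simp add: ln_div ln_mult)
      also have "\<dots> \<le> ?m * (ln ?m - ln ?n - (ln ?mR - ln ?nR) - (ln ?mT - ln ?nT) + ?c)"
        using m n' by (intro mult_left_mono) auto
      also have "\<dots> = ?m * ln (?m / ?n) - ?m * ln (?mR / ?nR) - ?m * ln (?mT / ?nT) + ?c * ?m"
        using m n by (simp add: ln_div algebra_simps)
      finally show ?thesis by simp
    qed
  qed
  also have "\<dots> = relent \<mu> \<nu> ?W - relent \<mu> \<nu> R - relent \<mu> \<nu> T"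
    using relent_sum_Un[OF assms] relent_sum_Un[of T R] assms
    by (simp add: sum_subtractf Int_commute Un_commute relent_def[of _ _ "R \<union> T"])
  finally have "(\<Sum>\<zeta>\<in>configs ?W. cyl \<mu> ?W \<zeta> - cyl \<mu> R \<zeta> * cyl \<mu> T \<zeta> - ?c * cyl \<mu> ?W \<zeta>)
      \<le> relent \<mu> \<nu> ?W - relent \<mu> \<nu> R - relent \<mu> \<nu> T" .
  moreover have "(\<Sum>\<zeta>\<in>configs ?W. cyl \<mu> ?W \<zeta> - cyl \<mu> R \<zeta> * cyl \<mu> T \<zeta> - ?c * cyl \<mu> ?W \<zeta>) = - ?c"
    using assms by (simp add: sum_subtractf prod mu.cyl_sum flip: sum_distrib_left)
  ultimately show ?thesis by simp
qed

text \<open>By the chain rule the difference is the expected relative entropy of the conditional law of one spin.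
Its entropy part has the favourable sign, and the rest is controlled by the lower bound on the
conditional probabilities of \<open>\<nu>\<close>.\<close>

lemma relent_insert_le:
  assumes "finite R" "x \<notin> R"
  shows "relent \<mu> \<nu> (insert x R) \<le> relent \<mu> \<nu> R + site_cost TYPE('d) \<beta>"
proof -
  let ?W = "R \<union> {x}" and ?\<kappa> = "weight_bound TYPE('d) \<beta> 1"
  have d: "finite {x}" "R \<inter> {x} = {}" using assms by auto
  have "relent \<mu> \<nu> ?W - relent \<mu> \<nu> R
    = (\<Sum>\<zeta>\<in>configs ?W. cyl \<mu> ?W \<zeta> * ln (cyl \<mu> ?W \<zeta> / cyl \<nu> ?W \<zeta>) - cyl \<mu> ?W \<zeta> * ln (cyl \<mu> R \<zeta> / cyl \<nu> R \<zeta>))"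
    unfolding relent_sum_Un[OF assms(1) d] relent_def[of _ _ ?W] by (simp add: sum_subtractf)
  also have "\<dots> \<le> (\<Sum>\<zeta>\<in>configs ?W. cyl \<mu> ?W \<zeta> * site_cost TYPE('d) \<beta>)"
  proof (rule sum_mono)
    fix \<zeta> assume \<zeta>: "\<zeta> \<in> configs ?W"
    let ?m = "cyl \<mu> ?W \<zeta>" and ?mR = "cyl \<mu> R \<zeta>" and ?n = "cyl \<nu> ?W \<zeta>" and ?nR = "cyl \<nu> R \<zeta>"
    show "?m * ln (?m / ?n) - ?m * ln (?mR / ?nR) \<le> ?m * site_cost TYPE('d) \<beta>"
    proof (cases "?m = 0")
      case False
      have le: "?m \<le> ?mR" using assms by (auto intro: mu.cyl_mono)
      with False have m: "?m > 0" "?mR > 0" using mu.cyl_nonneg[of ?W \<zeta>] by linarith+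
      have r: "restrict \<zeta> R \<in> configs R" "restrict \<zeta> {x} \<in> configs {x}"
        using \<zeta> by (auto intro!: restrict_configs)
      have n: "?n > 0" "?nR > 0"
        using nu_cyl_pos[OF _ \<zeta>] nu_cyl_pos[OF _ r(1)] assms cyl_cong[of R "restrict \<zeta> R" \<zeta> \<nu>] by auto
      have "?\<kappa> * ?nR \<le> ?n"
        using gibbs_cyl_ge[OF beta_nonneg gibbs assms(1) d r(2), of "restrict \<zeta> R"]
          cyl_cong[of R "restrict \<zeta> R" \<zeta> \<nu>]
        by (simp only: restrict_override[OF \<zeta>]) simp
      then have "ln (?\<kappa> * ?nR) \<le> ln ?n"
        using n weight_bound_pos[of \<beta> 1, where 'd = 'd] by (subst ln_le_cancel_iff) auto
      then have n': "ln ?nR - ln ?n \<le> site_cost TYPE('d) \<beta>"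
        using n weight_bound_pos[of \<beta> 1, where 'd = 'd] by (simp add: ln_mult site_cost_def)
      have "ln ?m \<le> ln ?mR" using le m by simp
      with n' have "ln ?m - ln ?n - (ln ?mR - ln ?nR) \<le> site_cost TYPE('d) \<beta>" by linarith
      then have "?m * (ln ?m - ln ?n - (ln ?mR - ln ?nR)) \<le> ?m * site_cost TYPE('d) \<beta>"
        using m by (intro mult_left_mono) auto
      then show ?thesis using m n by (simp add: ln_div algebra_simps)
    qed simp
  qed
  also have "\<dots> = site_cost TYPE('d) \<beta>" using assms by (simp add: mu.cyl_sum flip: sum_distrib_right)
  finally show ?thesis by simp
qed

end

section \<open>The entropy cost of a finite region\<close>

text \<open>Two configurations are connected by flipping the sites at which they differ one after the other.\<close>

lemma spin_flip_path:
  fixes F :: "'d::finite config \<Rightarrow> real"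
  assumes "finite S" "S \<subseteq> T" "\<eta> \<in> configs T" "\<eta>' \<in> configs T"
    and "\<And>x. x \<notin> S \<Longrightarrow> \<eta> x = \<eta>' x"
    and "\<And>x \<eta>. x \<in> T \<Longrightarrow> \<eta> \<in> configs T \<Longrightarrow> \<bar>F \<eta> - F (flip x \<eta>)\<bar> \<le> D x"
  shows "\<bar>F \<eta> - F \<eta>'\<bar> \<le> (\<Sum>x\<in>S. D x)"
  using assms(1-5)
proof (induction S arbitrary: \<eta>' rule: finite_induct)
  case empty
  then have "\<eta> = \<eta>'" by auto
  then show ?case by simp
next
  case (insert x S)
  show ?case
  proof (cases "\<eta>' x = \<eta> x")
    case True
    with insert.prems have "\<eta> y = \<eta>' y" if "y \<notin> S" for y using that by (cases "y = x") auto
    then have "\<bar>F \<eta> - F \<eta>'\<bar> \<le> sum D S" using insert.IH[of \<eta>'] insert.prems by auto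
    moreover have "0 \<le> D x" using assms(6)[of x \<eta>] insert.prems by auto
    ultimately show ?thesis using insert.hyps by simp
  next
    case False
    have xT: "x \<in> T" using insert.prems by auto
    then have "flip x \<eta>' x = \<eta> x"
      using False configs_spin[OF insert.prems(2) xT] configs_spin[OF insert.prems(3) xT]
      by (auto simp: flip_apply)
    with insert.prems have "\<eta> y = flip x \<eta>' y" if "y \<notin> S" for y
      using that by (cases "y = x") (auto simp: flip_apply)
    then have "\<bar>F \<eta> - F (flip x \<eta>')\<bar> \<le> sum D S"
      using insert.IH[of "flip x \<eta>'"] insert.prems xT by auto
    moreover have "\<bar>F \<eta>' - F (flip x \<eta>')\<bar> \<le> D x" using assms(6)[OF xT insert.prems(3)] .
    ultimately show ?thesis using insert.hyps by simp
  qed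
qed

text \<open>A Poincare inequality for an arbitrary probability vector \<open>w\<close> on a finite configuration space: the
deviation of \<open>F\<close> from its mean is at most its oscillation, and the oscillation is at most the sum of
the flip differences along a path. The right side is not weighted by \<open>w\<close>, and the constant is far
from optimal. Both are harmless because the region \<open>T\<close> stays fixed while the box grows.\<close>

lemma spin_flip_poincare:
  fixes F :: "'d::finite config \<Rightarrow> real"
  assumes "finite T" "\<And>\<eta>. \<eta> \<in> configs T \<Longrightarrow> w \<eta> \<ge> 0" "(\<Sum>\<eta>\<in>configs T. w \<eta>) = 1"
    and mean: "(\<Sum>\<eta>\<in>configs T. w \<eta> * F \<eta>) = c"
  shows "(\<Sum>\<eta>\<in>configs T. w \<eta> * (F \<eta> - c)\<^sup>2)
    \<le> card T * (\<Sum>x\<in>T. \<Sum>\<eta>\<in>configs T. (F \<eta> - F (flip x \<eta>))\<^sup>2)"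
proof -
  define D where "D x = sqrt (\<Sum>\<eta>\<in>configs T. (F \<eta> - F (flip x \<eta>))\<^sup>2)" for x
  have D2: "(D x)\<^sup>2 = (\<Sum>\<eta>\<in>configs T. (F \<eta> - F (flip x \<eta>))\<^sup>2)" for x
    unfolding D_def by (intro real_sqrt_pow2 sum_nonneg) auto
  have D: "\<bar>F \<eta> - F (flip x \<eta>)\<bar> \<le> D x" if "\<eta> \<in> configs T" for x \<eta>
  proof -
    have "(F \<eta> - F (flip x \<eta>))\<^sup>2 \<le> (\<Sum>\<eta>\<in>configs T. (F \<eta> - F (flip x \<eta>))\<^sup>2)"
      using assms(1) that by (intro member_le_sum) auto
    then show ?thesis unfolding D_def by (intro real_le_rsqrt) simp
  qed
  have pair: "\<bar>F \<eta> - F \<eta>'\<bar> \<le> sum D T" if "\<eta> \<in> configs T" "\<eta>' \<in> configs T" for \<eta> \<eta>'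
  proof (rule spin_flip_path[OF assms(1) order_refl that])
    show "\<eta> x = \<eta>' x" if "x \<notin> T" for x
      using that \<open>\<eta> \<in> configs T\<close> \<open>\<eta>' \<in> configs T\<close> by (auto simp: configs_def PiE_iff extensional_def)
  qed (rule D)
  have dev: "\<bar>F \<eta> - c\<bar> \<le> sum D T" if \<eta>: "\<eta> \<in> configs T" for \<eta>
  proof -
    have "F \<eta> - c = (\<Sum>\<eta>'\<in>configs T. w \<eta>' * (F \<eta> - F \<eta>'))"
      by (simp add: right_diff_distrib sum_subtractf mean assms(3) flip: sum_distrib_right)
    then have "\<bar>F \<eta> - c\<bar> \<le> (\<Sum>\<eta>'\<in>configs T. \<bar>w \<eta>' * (F \<eta> - F \<eta>')\<bar>)" by (simp add: sum_abs)
    also have "\<dots> \<le> (\<Sum>\<eta>'\<in>configs T. w \<eta>' * sum D T)"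
      using assms(2) pair[OF \<eta>] by (intro sum_mono) (auto simp: abs_mult intro!: mult_left_mono)
    finally show ?thesis by (simp add: assms(3) flip: sum_distrib_right)
  qed
  have "(\<Sum>\<eta>\<in>configs T. w \<eta> * (F \<eta> - c)\<^sup>2) \<le> (\<Sum>\<eta>\<in>configs T. w \<eta> * (sum D T)\<^sup>2)"
    using assms(2) order.trans[OF dev abs_ge_self]
    by (intro sum_mono mult_left_mono) (auto simp: abs_le_square_iff[symmetric])
  also have "\<dots> = (sum D T)\<^sup>2" by (simp add: assms(3) flip: sum_distrib_right)
  also have "\<dots> \<le> (\<Sum>x\<in>T. (D x)\<^sup>2) * card T" by (rule sum_squared_le_sum_of_squares)
  finally show ?thesis by (simp add: D2 mult.commute)
qed

text \<open>The mean value theorem for the logarithm, whose derivative is at least \<open>1 / U\<close> below \<open>U\<close>. The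
hypothesis that \<open>a\<close> and \<open>b\<close> vanish together excludes the case in which the value \<open>ln 0 = 0\<close> would
make the right side too small.\<close>

lemma mult_ln_diff_ge:
  fixes a b U :: real
  assumes "0 \<le> a" "0 \<le> b" "a \<le> U" "b \<le> U" "U > 0" "a > 0 \<longleftrightarrow> b > 0"
  shows "(a - b)\<^sup>2 / U \<le> (a - b) * (ln a - ln b)"
proof -
  have *: "(a - b)\<^sup>2 / U \<le> (a - b) * (ln a - ln b)" if "0 < b" "b \<le> a" "a \<le> U" for a b :: real
  proof -
    have "ln (b / a) \<le> b / a - 1" using that by (intro ln_le_minus_one) auto
    then have "ln a - ln b \<ge> (a - b) / a" using that by (simp add: ln_div field_simps)
    moreover have "(a - b) / a \<ge> (a - b) / U" using that by (intro divide_left_mono) auto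
    ultimately have "(a - b) * ((a - b) / U) \<le> (a - b) * (ln a - ln b)"
      using that by (intro mult_left_mono) auto
    then show ?thesis by (simp add: power2_eq_square)
  qed
  show ?thesis
  proof (cases "a = 0 \<or> b = 0")
    case True
    then show ?thesis using assms by (cases "a = 0"; cases "b = 0") auto
  next
    case False
    then show ?thesis
      using *[of a b] *[of b a] assms by (cases "b \<le> a") (auto simp: power2_commute algebra_simps)
  qed
qed

definition flux :: "real \<Rightarrow> 'd::finite config measure \<Rightarrow> 'd site \<Rightarrow> 'd site set \<Rightarrow> 'd config \<Rightarrow> real" where
  "flux \<beta> \<mu> x W \<zeta> = flip_rate \<beta> x \<zeta> * cyl \<mu> W \<zeta>"

text \<open>The finite-volume form of the entropy production at \<open>x\<close>: the relative entropy between the measure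
\<open>c(x, \<cdot>) \<mu>\<close> and its image under the flip at \<open>x\<close>, both restricted to the spins in \<open>W\<close>.\<close>

definition local_production :: "real \<Rightarrow> 'd::finite config measure \<Rightarrow> 'd site \<Rightarrow> 'd site set \<Rightarrow> real" where
  "local_production \<beta> \<mu> x W
     = (\<Sum>\<zeta>\<in>configs W. flux \<beta> \<mu> x W \<zeta> * ln (flux \<beta> \<mu> x W \<zeta> / flux \<beta> \<mu> x W (flip x \<zeta>)))"

text \<open>The flip at \<open>x\<close> is an involution, so the sum can be averaged with its image under the flip. All terms
of the symmetrised sum are nonnegative, which makes term by term estimates possible.\<close>

lemma local_production_symmetric:
  assumes "spin_law \<mu>" "x \<in> W"
    and "\<And>\<zeta>. \<zeta> \<in> configs W \<Longrightarrow> flux \<beta> \<mu> x W \<zeta> > 0 \<Longrightarrow> flux \<beta> \<mu> x W (flip x \<zeta>) > 0"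
  defines "P \<equiv> flux \<beta> \<mu> x W"
  shows "2 * local_production \<beta> \<mu> x W
    = (\<Sum>\<zeta>\<in>configs W. (P \<zeta> - P (flip x \<zeta>)) * (ln (P \<zeta>) - ln (P (flip x \<zeta>))))"
proof -
  interpret spin_law \<mu> by fact
  have nonneg: "P \<zeta> \<ge> 0" for \<zeta> by (simp add: P_def flux_def flip_rate_def cyl_nonneg)
  let ?G = "\<lambda>\<zeta>. P \<zeta> * (ln (P \<zeta>) - ln (P (flip x \<zeta>)))"
  have "P \<zeta> * ln (P \<zeta> / P (flip x \<zeta>)) = ?G \<zeta>" if "\<zeta> \<in> configs W" for \<zeta>
    using assms(3)[OF that] nonneg[of \<zeta>] by (cases "P \<zeta> = 0") (auto simp: ln_div P_def)
  then have 1: "local_production \<beta> \<mu> x W = (\<Sum>\<zeta>\<in>configs W. ?G \<zeta>)"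
    unfolding local_production_def P_def[symmetric] by (rule sum.cong[OF refl])
  also have "\<dots> = (\<Sum>\<zeta>\<in>configs W. ?G (flip x \<zeta>))"
    using assms(2) by (intro sum.reindex_bij_witness[of _ "flip x" "flip x"]) auto
  finally have "2 * local_production \<beta> \<mu> x W = (\<Sum>\<zeta>\<in>configs W. ?G \<zeta> + ?G (flip x \<zeta>))"
    using 1 by (simp add: sum.distrib)
  then show ?thesis by (simp add: algebra_simps)
qed

context gibbs_pair
begin

text \<open>The density of the conditional law of the spins in \<open>T\<close> under \<open>\<mu>\<close>, given the configuration \<open>\<xi>\<close> in \<open>R\<close>,
with respect to the Gibbs distribution on \<open>T\<close>.\<close>

definition cond_ratio :: "'d site set \<Rightarrow> 'd site set \<Rightarrow> 'd config \<Rightarrow> 'd config \<Rightarrow> real" where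
  "cond_ratio R T \<xi> \<eta>
     = cyl \<mu> (R \<union> T) (override_on \<xi> \<eta> T) / (cyl \<mu> R \<xi> * gibbs_weight \<beta> T \<xi> \<eta>)"

text \<open>By detailed balance the rates \<open>q\<close> at which the Gibbs distribution jumps from \<open>\<eta>\<close> to \<open>flip x \<eta>\<close> and
back agree. Hence the two probability fluxes of \<open>\<mu>\<close> through this edge are \<open>M * q\<close> times the values
of the density \<open>cond_ratio\<close> at the two ends, where \<open>M\<close> is the probability of \<open>\<xi>\<close>, and the entropy
production controls the squared difference of these values.\<close>

lemma dirichlet_le_local_production:
  assumes "finite R" "finite T" "R \<inter> T = {}" "x \<in> T"
    and nb: "\<And>x y. (x, y) \<in> boundary_edges T \<Longrightarrow> y \<in> R"
    and ac: "\<And>\<zeta>. \<zeta> \<in> configs (R \<union> T) \<Longrightarrow> flux \<beta> \<mu> x (R \<union> T) \<zeta> > 0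
               \<Longrightarrow> flux \<beta> \<mu> x (R \<union> T) (flip x \<zeta>) > 0"
  shows "(\<Sum>\<xi>\<in>configs R. cyl \<mu> R \<xi> * (\<Sum>\<eta>\<in>configs T. (cond_ratio R T \<xi> \<eta> - cond_ratio R T \<xi> (flip x \<eta>))\<^sup>2))
    \<le> 2 * rate_bound TYPE('d) \<beta> ^ 3 / (weight_bound TYPE('d) \<beta> (card T))\<^sup>2 * local_production \<beta> \<mu> x (R \<union> T)"
proof -
  let ?W = "R \<union> T" and ?D = "card {y :: 'd site. nbr y 0}" and ?F = "cond_ratio R T"
  let ?\<kappa> = "weight_bound TYPE('d) \<beta> (card T)"
  let ?P = "flux \<beta> \<mu> x ?W"
  define K where "K = rate_bound TYPE('d) \<beta> ^ 3 / ?\<kappa>\<^sup>2"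
  have rb: "rate_bound TYPE('d) \<beta> > 0" by (simp add: rate_bound_def)
  have xW: "x \<in> ?W" using assms(4) by auto
  have nW: "{y. nbr y x} \<subseteq> ?W"
    using nb assms(4) by (auto simp: boundary_edges_def nbr_sym)
  have \<kappa>: "?\<kappa> > 0" by (rule weight_bound_pos)
  have step: "cyl \<mu> R \<xi> * (?F \<xi> \<eta> - ?F \<xi> (flip x \<eta>))\<^sup>2
      \<le> K * ((?P \<zeta> - ?P (flip x \<zeta>)) * (ln (?P \<zeta>) - ln (?P (flip x \<zeta>))))"
    if \<xi>: "\<xi> \<in> configs R" and \<eta>: "\<eta> \<in> configs T" and \<zeta>_def: "\<zeta> = override_on \<xi> \<eta> T" for \<xi> \<eta> \<zeta>
  proof -
    have \<zeta>: "\<zeta> \<in> configs ?W" using \<xi> \<eta> \<zeta>_def override_on_configs by auto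
    have \<eta>': "flip x \<eta> \<in> configs T" using \<eta> assms(4) by auto
    have \<zeta>'_def: "flip x \<zeta> = override_on \<xi> (flip x \<eta>) T"
      using assms(4) by (auto simp: \<zeta>_def override_on_def flip_apply)
    have \<zeta>': "flip x \<zeta> \<in> configs ?W" using \<zeta> xW by auto
    define M where "M = cyl \<mu> R \<xi>"
    let ?w = "gibbs_weight \<beta> T \<xi>"
    define q where "q = flip_rate \<beta> x \<zeta> * ?w \<eta>"
    have q': "q = flip_rate \<beta> x (flip x \<zeta>) * ?w (flip x \<eta>)"
      using detailed_balance[OF assms(2,4), of \<beta> \<xi> \<eta>] by (simp add: q_def \<zeta>_def flip: \<zeta>'_def)
    have acP: "?P \<zeta> > 0 \<longleftrightarrow> ?P (flip x \<zeta>) > 0"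
      using ac[OF \<zeta>] ac[OF \<zeta>'] by auto
    have P0: "?P \<zeta> \<ge> 0" for \<zeta> by (simp add: flux_def flip_rate_def mu.cyl_nonneg)
    show ?thesis
    proof (cases "M = 0")
      case True
      have "0 \<le> (?P \<zeta> - ?P (flip x \<zeta>)) * (ln (?P \<zeta>) - ln (?P (flip x \<zeta>)))"
        using mult_ln_diff_ge[of "?P \<zeta>" "?P (flip x \<zeta>)" "1 + ?P \<zeta> + ?P (flip x \<zeta>)"] P0[of \<zeta>] P0[of "flip x \<zeta>"] acP
        by (smt (verit) divide_nonneg_pos zero_le_power2)
      then show ?thesis using True rb \<kappa> by (simp add: M_def K_def)
    next
      case False
      then have M: "M > 0" using mu.cyl_nonneg[of R \<xi>] by (simp add: M_def)
      \<comment> \<open>The lower bound on Gibbs weights is stated for boundary conditions on the whole lattice, while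
        \<open>\<xi>\<close> is undefined outside \<open>R\<close>. Its values there do not enter the weights.\<close>
      obtain \<omega> where \<omega>: "\<omega> \<in> configs UNIV" "\<And>y. y \<in> R \<Longrightarrow> \<omega> y = \<xi> y"
      proof
        show "(\<lambda>y. if y \<in> R then \<xi> y else 1) \<in> configs UNIV"
          using \<xi> by (auto simp: configs_def PiE_iff)
      qed auto
      have w: "?w \<eta> = gibbs_weight \<beta> T \<omega> \<eta>" for \<eta>
        using \<omega>(2) nb by (intro gibbs_weight_cong) auto
      have wpos: "?w \<eta> > 0" for \<eta> using assms(2) by (rule gibbs_weight_pos)
      have w\<eta>: "?\<kappa> \<le> ?w \<eta>"
        unfolding w using assms(2) \<omega>(1) \<eta> beta_nonneg by (intro gibbs_weight_ge_weight_bound) auto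
      have r: "1 / rate_bound TYPE('d) \<beta> \<le> flip_rate \<beta> x \<zeta>" "flip_rate \<beta> x \<zeta> \<le> rate_bound TYPE('d) \<beta>"
          "flip_rate \<beta> x (flip x \<zeta>) \<le> rate_bound TYPE('d) \<beta>"
        using flip_rate_bounds[OF beta_nonneg \<zeta> xW nW] flip_rate_bounds[OF beta_nonneg \<zeta>' xW nW]
        by (auto simp: rate_bound_def exp_minus divide_inverse)
      have q: "?\<kappa> / rate_bound TYPE('d) \<beta> \<le> q"
      proof -
        have "1 / rate_bound TYPE('d) \<beta> * ?\<kappa> \<le> flip_rate \<beta> x \<zeta> * ?w \<eta>"
          using r(1) w\<eta> rb \<kappa> by (intro mult_mono) (auto simp: flip_rate_def)
        then show ?thesis by (simp add: q_def)
      qed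
      have P1: "?P \<zeta> = M * q * ?F \<xi> \<eta>"
        using M wpos[of \<eta>] by (simp add: flux_def q_def cond_ratio_def \<zeta>_def M_def field_simps)
      have P2: "?P (flip x \<zeta>) = M * q * ?F \<xi> (flip x \<eta>)"
        using M wpos[of "flip x \<eta>"]
        by (simp add: flux_def q' cond_ratio_def \<zeta>'_def M_def field_simps)
      have mM: "cyl \<mu> ?W (override_on \<xi> \<eta> T) \<le> M" for \<eta>
      proof -
        have "cyl \<mu> ?W (override_on \<xi> \<eta> T) \<le> cyl \<mu> R (override_on \<xi> \<eta> T)"
          using assms(1) by (intro mu.cyl_mono) auto
        then show ?thesis using assms(3) by (simp add: M_def cyl_override_left)
      qed
      have PU: "?P \<zeta> \<le> rate_bound TYPE('d) \<beta> * M" "?P (flip x \<zeta>) \<le> rate_bound TYPE('d) \<beta> * M"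
        unfolding flux_def using r mM[of \<eta>] mM[of "flip x \<eta>"] rb
        by (auto simp flip: \<zeta>_def \<zeta>'_def intro!: mult_mono mu.cyl_nonneg)
      have "M * (?F \<xi> \<eta> - ?F \<xi> (flip x \<eta>))\<^sup>2 * (?\<kappa> / rate_bound TYPE('d) \<beta>)\<^sup>2
          \<le> M * (?F \<xi> \<eta> - ?F \<xi> (flip x \<eta>))\<^sup>2 * q\<^sup>2"
        using q M \<kappa> rb by (intro mult_left_mono power_mono) auto
      also have "\<dots> = rate_bound TYPE('d) \<beta> * ((?P \<zeta> - ?P (flip x \<zeta>))\<^sup>2 / (rate_bound TYPE('d) \<beta> * M))"
        unfolding P1 P2 using M rb by (simp add: power2_eq_square field_simps)
      also have "\<dots> \<le> rate_bound TYPE('d) \<beta> * ((?P \<zeta> - ?P (flip x \<zeta>)) * (ln (?P \<zeta>) - ln (?P (flip x \<zeta>))))"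
        using rb M P0 PU acP by (intro mult_left_mono mult_ln_diff_ge) auto
      finally show ?thesis
        using rb \<kappa> by (simp add: K_def M_def field_simps power2_eq_square power3_eq_cube)
    qed
  qed
  have "(\<Sum>\<xi>\<in>configs R. cyl \<mu> R \<xi> * (\<Sum>\<eta>\<in>configs T. (?F \<xi> \<eta> - ?F \<xi> (flip x \<eta>))\<^sup>2))
      \<le> (\<Sum>\<xi>\<in>configs R. \<Sum>\<eta>\<in>configs T. K * ((?P (override_on \<xi> \<eta> T) - ?P (flip x (override_on \<xi> \<eta> T)))
          * (ln (?P (override_on \<xi> \<eta> T)) - ln (?P (flip x (override_on \<xi> \<eta> T))))))"
    unfolding sum_distrib_left by (intro sum_mono step refl)
  also have "\<dots> = (\<Sum>\<zeta>\<in>configs ?W. K * ((?P \<zeta> - ?P (flip x \<zeta>)) * (ln (?P \<zeta>) - ln (?P (flip x \<zeta>)))))"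
    by (rule sum_configs_Un[symmetric]) fact
  also have "\<dots> = K * (2 * local_production \<beta> \<mu> x ?W)"
    using local_production_symmetric[OF mu.spin_law_axioms xW ac] by (simp flip: sum_distrib_left)
  finally show ?thesis by (simp add: K_def mult.commute mult.left_commute)
qed

text \<open>By the chain rule the increase of relative entropy is the expected relative entropy of the
conditional law on \<open>T\<close> with respect to the Gibbs distribution, which is the conditional law of
\<open>\<nu>\<close> because \<open>R\<close> contains the outer boundary of \<open>T\<close>. Relative entropy is at most the chi-square
distance, that is, the variance of \<open>cond_ratio\<close>, and the Poincare inequality reduces the variance to
flip differences.\<close>

lemma relent_tile_le:
  assumes "finite R" "finite T" "R \<inter> T = {}"
    and nb: "\<And>x y. (x, y) \<in> boundary_edges T \<Longrightarrow> y \<in> R"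
    and ac: "\<And>x \<zeta>. x \<in> T \<Longrightarrow> \<zeta> \<in> configs (R \<union> T) \<Longrightarrow> flux \<beta> \<mu> x (R \<union> T) \<zeta> > 0
               \<Longrightarrow> flux \<beta> \<mu> x (R \<union> T) (flip x \<zeta>) > 0"
    and s: "\<And>x. x \<in> T \<Longrightarrow> local_production \<beta> \<mu> x (R \<union> T) \<le> s"
  shows "relent \<mu> \<nu> (R \<union> T) \<le> relent \<mu> \<nu> R
    + 2 * (card T)\<^sup>2 * rate_bound TYPE('d) \<beta> ^ 3 / (weight_bound TYPE('d) \<beta> (card T))\<^sup>2 * s"
proof -
  let ?W = "R \<union> T" and ?F = "cond_ratio R T" and ?w = "gibbs_weight \<beta> T"
  let ?K = "2 * rate_bound TYPE('d) \<beta> ^ 3 / (weight_bound TYPE('d) \<beta> (card T))\<^sup>2"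
  have K: "?K \<ge> 0" by (simp add: rate_bound_def)
  have "relent \<mu> \<nu> ?W - relent \<mu> \<nu> R = (\<Sum>\<zeta>\<in>configs ?W. cyl \<mu> ?W \<zeta> * ln (cyl \<mu> ?W \<zeta> / cyl \<nu> ?W \<zeta>)
       - cyl \<mu> ?W \<zeta> * ln (cyl \<mu> R \<zeta> / cyl \<nu> R \<zeta>))"
    unfolding relent_sum_Un[OF assms(1-3)] relent_def[of _ _ ?W] by (simp add: sum_subtractf)
  also have "\<dots> = (\<Sum>\<xi>\<in>configs R. \<Sum>\<eta>\<in>configs T.
      cyl \<mu> ?W (override_on \<xi> \<eta> T) * ln (cyl \<mu> ?W (override_on \<xi> \<eta> T) / cyl \<nu> ?W (override_on \<xi> \<eta> T))
       - cyl \<mu> ?W (override_on \<xi> \<eta> T) * ln (cyl \<mu> R \<xi> / cyl \<nu> R \<xi>))"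
    using assms(3) by (simp add: sum_configs_Un cyl_override_left)
  also have "\<dots> \<le> (\<Sum>\<xi>\<in>configs R. cyl \<mu> R \<xi> * (\<Sum>\<eta>\<in>configs T. ?w \<xi> \<eta> * (?F \<xi> \<eta> - 1)\<^sup>2))"
  proof (rule sum_mono)
    fix \<xi> assume \<xi>: "\<xi> \<in> configs R"
    let ?M = "cyl \<mu> R \<xi>" and ?N = "cyl \<nu> R \<xi>"
    let ?m = "\<lambda>\<eta>. cyl \<mu> ?W (override_on \<xi> \<eta> T)" and ?n = "\<lambda>\<eta>. cyl \<nu> ?W (override_on \<xi> \<eta> T)"
    have msum: "(\<Sum>\<eta>\<in>configs T. ?m \<eta>) = ?M" using assms(1-3) by (rule mu.cyl_marginal)
    have w: "?w \<xi> \<eta> > 0" for \<eta> using assms(2) by (rule gibbs_weight_pos)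
    show "(\<Sum>\<eta>\<in>configs T. ?m \<eta> * ln (?m \<eta> / ?n \<eta>) - ?m \<eta> * ln (?M / ?N))
        \<le> ?M * (\<Sum>\<eta>\<in>configs T. ?w \<xi> \<eta> * (?F \<xi> \<eta> - 1)\<^sup>2)"
    proof (cases "?M = 0")
      case True
      with msum have "\<forall>\<eta>\<in>configs T. ?m \<eta> = 0"
        using sum_nonneg_eq_0_iff[OF finite_configs[OF assms(2)], of ?m] by (simp add: mu.cyl_nonneg)
      then show ?thesis using True by simp
    next
      case False
      then have M: "?M > 0" using mu.cyl_nonneg[of R \<xi>] by simp
      have N: "?N > 0" using nu_cyl_pos[OF assms(1) \<xi>] .
      have F: "?F \<xi> \<eta> = ?m \<eta> / (?M * ?w \<xi> \<eta>)" for \<eta> by (simp add: cond_ratio_def)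
      have "(\<Sum>\<eta>\<in>configs T. ?m \<eta> * ln (?m \<eta> / ?n \<eta>) - ?m \<eta> * ln (?M / ?N))
          \<le> (\<Sum>\<eta>\<in>configs T. ?M * ?w \<xi> \<eta> * (?F \<xi> \<eta> * (?F \<xi> \<eta> - 1)))"
      proof (rule sum_mono)
        fix \<eta> assume \<eta>: "\<eta> \<in> configs T"
        have n: "?n \<eta> = ?w \<xi> \<eta> * ?N"
          using gibbs_cyl_boundary[OF gibbs assms(1-3) \<eta>] nb by blast
        show "?m \<eta> * ln (?m \<eta> / ?n \<eta>) - ?m \<eta> * ln (?M / ?N) \<le> ?M * ?w \<xi> \<eta> * (?F \<xi> \<eta> * (?F \<xi> \<eta> - 1))"
        proof (cases "?m \<eta> = 0")
          case True
          then show ?thesis by (simp add: F)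
        next
          case False
          then have m: "?m \<eta> > 0" using mu.cyl_nonneg[of ?W "override_on \<xi> \<eta> T"] by simp
          have "?m \<eta> * ln (?m \<eta> / ?n \<eta>) - ?m \<eta> * ln (?M / ?N) = ?m \<eta> * ln (?F \<xi> \<eta>)"
            using m M N w[of \<eta>] by (simp add: n F ln_div ln_mult algebra_simps)
          also have "\<dots> \<le> ?m \<eta> * (?F \<xi> \<eta> - 1)"
            using m M w[of \<eta>] by (intro mult_left_mono ln_le_minus_one) (auto simp: F)
          also have "\<dots> = ?M * ?w \<xi> \<eta> * (?F \<xi> \<eta> * (?F \<xi> \<eta> - 1))"
            using M w[of \<eta>] by (simp add: F)
          finally show ?thesis .
        qed
      qed
      also have "\<dots> = ?M * (\<Sum>\<eta>\<in>configs T. ?w \<xi> \<eta> * (?F \<xi> \<eta> - 1)\<^sup>2)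
          + (\<Sum>\<eta>\<in>configs T. ?M * ?w \<xi> \<eta> * ?F \<xi> \<eta> - ?M * ?w \<xi> \<eta>)"
        unfolding sum_distrib_left sum.distrib[symmetric]
        by (intro sum.cong refl) (simp add: power2_eq_square algebra_simps)
      also have "(\<Sum>\<eta>\<in>configs T. ?M * ?w \<xi> \<eta> * ?F \<xi> \<eta> - ?M * ?w \<xi> \<eta>) = 0"
      proof -
        have "?M * ?w \<xi> \<eta> * ?F \<xi> \<eta> = ?m \<eta>" for \<eta> using M w[of \<eta>] by (simp add: F)
        then show ?thesis
          by (simp add: sum_subtractf msum gibbs_weight_sum[OF assms(2)] flip: sum_distrib_left)
      qed
      finally show ?thesis by simp
    qed
  qed
  also have "\<dots> \<le> (\<Sum>\<xi>\<in>configs R. cyl \<mu> R \<xi> * (card T * (\<Sum>x\<in>T. \<Sum>\<eta>\<in>configs T. (?F \<xi> \<eta> - ?F \<xi> (flip x \<eta>))\<^sup>2)))"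
  proof (rule sum_mono)
    fix \<xi> assume \<xi>: "\<xi> \<in> configs R"
    show "cyl \<mu> R \<xi> * (\<Sum>\<eta>\<in>configs T. ?w \<xi> \<eta> * (?F \<xi> \<eta> - 1)\<^sup>2)
      \<le> cyl \<mu> R \<xi> * (card T * (\<Sum>x\<in>T. \<Sum>\<eta>\<in>configs T. (?F \<xi> \<eta> - ?F \<xi> (flip x \<eta>))\<^sup>2))"
    proof (cases "cyl \<mu> R \<xi> = 0")
      case False
      have w: "?w \<xi> \<eta> > 0" for \<eta> using assms(2) by (rule gibbs_weight_pos)
      have "?w \<xi> \<eta> * ?F \<xi> \<eta> = cyl \<mu> ?W (override_on \<xi> \<eta> T) / cyl \<mu> R \<xi>" for \<eta>
        using w[of \<eta>] by (simp add: cond_ratio_def)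
      then have "(\<Sum>\<eta>\<in>configs T. ?w \<xi> \<eta> * ?F \<xi> \<eta>) = 1"
        using False mu.cyl_marginal[OF assms(1-3)] by (simp flip: sum_divide_distrib)
      then show ?thesis
        using w assms(2)
        by (intro mult_left_mono spin_flip_poincare)
           (auto simp: gibbs_weight_sum mu.cyl_nonneg intro: less_imp_le)
    qed simp
  qed
  also have "\<dots> = card T * (\<Sum>x\<in>T. \<Sum>\<xi>\<in>configs R. cyl \<mu> R \<xi> * (\<Sum>\<eta>\<in>configs T. (?F \<xi> \<eta> - ?F \<xi> (flip x \<eta>))\<^sup>2))"
    by (subst sum.swap) (simp add: sum_distrib_left mult.left_commute)
  also have "\<dots> \<le> card T * (\<Sum>x\<in>T. ?K * s)"
  proof (intro mult_left_mono sum_mono)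
    fix x assume x: "x \<in> T"
    have "(\<Sum>\<xi>\<in>configs R. cyl \<mu> R \<xi> * (\<Sum>\<eta>\<in>configs T. (?F \<xi> \<eta> - ?F \<xi> (flip x \<eta>))\<^sup>2))
        \<le> ?K * local_production \<beta> \<mu> x ?W"
      using x by (intro dirichlet_le_local_production assms(1-3) nb ac) auto
    also have "\<dots> \<le> ?K * s" using s[OF x] K by (rule mult_left_mono)
    finally show "(\<Sum>\<xi>\<in>configs R. cyl \<mu> R \<xi> * (\<Sum>\<eta>\<in>configs T. (?F \<xi> \<eta> - ?F \<xi> (flip x \<eta>))\<^sup>2)) \<le> ?K * s" .
  qed simp
  finally show ?thesis by (simp add: power2_eq_square algebra_simps)
qed

end

section \<open>Restriction to finitely many spins\<close>

text \<open>This is Jensen's inequality on a single set. The proof integrates the tangent line inequality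
\<open>D * ln D \<ge> D * ln r + D - r\<close> for the density \<open>D\<close>, at the value \<open>r = P(A) / Q(A)\<close> for which the last
two terms cancel after integration over \<open>A\<close>.\<close>

lemma entropy_density_set_integral_ge:
  assumes "finite_measure P" "finite_measure Q" "sets P = sets Q"
    and ac: "absolutely_continuous Q P" and int: "integrable P (entropy_density (exp 1) Q P)"
    and A: "A \<in> sets P"
  shows "measure P A * ln (measure P A / measure Q A)
    \<le> (\<integral>\<omega>\<in>A. entropy_density (exp 1) Q P \<omega> \<partial>P)"
proof (cases "measure P A = 0")
  case True
  interpret P: finite_measure P by fact
  have "A \<in> null_sets P" using True A by (simp add: P.emeasure_eq_measure null_sets_def)
  then have "(\<integral>\<omega>\<in>A. entropy_density (exp 1) Q P \<omega> \<partial>P) = 0"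
    unfolding set_lebesgue_integral_def
    by (intro integral_eq_zero_AE) (auto dest: AE_not_in elim!: eventually_mono simp: indicator_def)
  then show ?thesis using True by simp
next
  case False
  interpret P: finite_measure P by fact
  interpret Q: finite_measure Q by fact
  have P: "measure P A > 0" using False by (simp add: zero_less_measure_iff)
  have AQ: "A \<in> sets Q" using A assms(3) by simp
  have "measure Q A \<noteq> 0"
    using absolutely_continuousD[OF ac AQ] False
    by (auto simp: P.emeasure_eq_measure Q.emeasure_eq_measure)
  then have Q: "measure Q A > 0" by (simp add: zero_less_measure_iff)
  define r where "r = measure P A / measure Q A"
  have r: "r > 0" using P Q by (simp add: r_def)
  obtain D where D[measurable]: "D \<in> borel_measurable Q"
    and RN: "AE x in Q. RN_deriv Q P x = ennreal (D x)" and D0: "\<And>x. 0 \<le> D x"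
    using Q.real_RN_deriv[OF assms(1) ac assms(3)] by metis
  have "P = density Q (RN_deriv Q P)" using Q.density_RN_deriv[OF ac assms(3)] by simp
  also have "\<dots> = density Q D" using RN by (intro density_cong) auto
  finally have PD: "P = density Q D" .
  let ?E = "entropy_density (exp 1) Q P"
  have E: "AE x in Q. ?E x = ln (D x)"
    using RN D0 by (auto simp: entropy_density_def log_def elim!: eventually_mono)
  have iA: "integrable P (\<lambda>x. indicator A x * ?E x)"
    using integrable_mult_indicator[OF A int] by simp
  have i1: "integrable Q (\<lambda>x. D x * (indicator A x * ?E x))"
    using iA AQ D0 unfolding PD by (subst (asm) integrable_real_density) auto
  have iD: "integrable Q (\<lambda>x. indicator A x * D x)"
  proof -
    have "integrable P (indicator A :: _ \<Rightarrow> real)" using A by (simp add: P.emeasure_finite less_top[symmetric])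
    then have "integrable Q (\<lambda>x. D x * indicator A x)"
      unfolding PD using AQ D0 by (subst (asm) integrable_real_density) auto
    then show ?thesis by (simp add: mult.commute)
  qed
  have "measure P A = (\<integral>x. indicator A x \<partial>P)" using A by (simp add: Int_absorb1 sets.sets_into_space)
  also have "\<dots> = (\<integral>x. indicator A x * D x \<partial>Q)"
    unfolding PD using AQ D0 by (subst integral_density) (auto simp: mult.commute)
  finally have PA: "measure P A = (\<integral>x. indicator A x * D x \<partial>Q)" .
  have iQ: "integrable Q (\<lambda>x. indicator A x * r)"
    using AQ by (intro integrable_mult_left) (simp add: Q.emeasure_finite less_top[symmetric])
  have "measure P A * ln r = measure P A * (ln r + 1) - r * measure Q A"
    using Q by (simp add: r_def algebra_simps)
  also have "\<dots> = (\<integral>x. indicator A x * D x * (ln r + 1) - indicator A x * r \<partial>Q)"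
    using iD iQ AQ by (simp add: PA Int_absorb1 sets.sets_into_space)
  also have "\<dots> \<le> (\<integral>x. D x * (indicator A x * ?E x) \<partial>Q)"
  proof (rule integral_mono_AE)
    show "integrable Q (\<lambda>x. indicator A x * D x * (ln r + 1) - indicator A x * r)"
      using iD iQ by auto
    show "AE x in Q. indicator A x * D x * (ln r + 1) - indicator A x * r \<le> D x * (indicator A x * ?E x)"
      using E
    proof eventually_elim
      case (elim x)
      have "D x - r \<le> D x * ln (D x / r)" using D0 r by (intro mult_ln_ge) auto
      also have "\<dots> = D x * (ln (D x) - ln r)"
        using D0[of x] r by (cases "D x = 0") (auto simp: ln_div)
      finally show ?case using elim by (auto simp: indicator_def algebra_simps)
    qed
  qed (rule i1)
  also have "\<dots> = (\<integral>x. indicator A x * ?E x \<partial>P)"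
    unfolding PD using AQ D0 by (subst integral_density) (auto simp flip: PD)
  finally show ?thesis by (simp add: r_def set_lebesgue_integral_def)
qed

lemma KL_divergence_ge_finite_partition:
  assumes "finite_measure P" "finite_measure Q" "sets P = sets Q"
    and "absolutely_continuous Q P" and int: "integrable P (entropy_density (exp 1) Q P)"
    and "finite I" "disjoint_family_on A I" "\<And>i. i \<in> I \<Longrightarrow> A i \<in> sets P" "(\<Union>i\<in>I. A i) = space P"
  shows "(\<Sum>i\<in>I. measure P (A i) * ln (measure P (A i) / measure Q (A i))) \<le> KL_divergence (exp 1) Q P"
proof -
  have "(\<Sum>i\<in>I. measure P (A i) * ln (measure P (A i) / measure Q (A i)))
      \<le> (\<Sum>i\<in>I. \<integral>\<omega>\<in>A i. entropy_density (exp 1) Q P \<omega> \<partial>P)"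
    using assms by (intro sum_mono entropy_density_set_integral_ge) auto
  also have "\<dots> = (\<integral>\<omega>\<in>(\<Union>i\<in>I. A i). entropy_density (exp 1) Q P \<omega> \<partial>P)"
    using assms(6-8) integrable_mult_indicator[OF _ int]
    by (intro set_integral_finite_Union[symmetric]) (auto simp: set_integrable_def)
  also have "\<dots> = KL_divergence (exp 1) Q P"
    unfolding assms(9) set_lebesgue_integral_def KL_divergence_def
    by (intro Bochner_Integration.integral_cong) auto
  finally show ?thesis .
qed

lemma measurable_coordinate [measurable]:
  "(\<lambda>\<omega>. \<omega> x) \<in> spin_space UNIV \<rightarrow>\<^sub>M (count_space {-1, 1::real})"
  unfolding spin_space_def by measurable

lemma borel_measurable_coordinate [measurable]: "(\<lambda>\<omega>. \<omega> x) \<in> borel_measurable (spin_space UNIV)"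
  using measurable_compose[OF measurable_coordinate, of "\<lambda>x. x" borel x] by simp

lemma measurable_flip_rate [measurable]: "flip_rate \<beta> x \<in> borel_measurable (spin_space UNIV)"
  unfolding flip_rate_def by measurable

lemma measurable_flip [measurable]: "flip x \<in> spin_space UNIV \<rightarrow>\<^sub>M spin_space UNIV"
proof -
  have "(\<lambda>\<omega>. flip x \<omega> y) \<in> spin_space UNIV \<rightarrow>\<^sub>M count_space {-1, 1::real}" for y
  proof (cases "y = x")
    case True
    have "uminus \<in> count_space {-1, 1::real} \<rightarrow>\<^sub>M count_space {-1, 1::real}" by auto
    then show ?thesis
      using measurable_compose[OF measurable_coordinate, of uminus _ x] True by (simp add: flip_apply)
  qed (simp add: flip_apply measurable_coordinate)
  moreover have "flip x \<in> configs UNIV \<rightarrow> configs UNIV" by auto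
  ultimately show ?thesis
    unfolding spin_space_def[of UNIV]
    by (intro measurable_PiM_single') (simp_all add: space_PiM configs_def)
qed

text \<open>The entropy production is a relative entropy, so it does not increase when the two measures are
restricted to finitely many cylinder events. The window \<open>W\<close> has to contain the neighbours of the
origin so that the flip rate is constant on these events. The second part transfers absolute
continuity, which is implicit in a finite entropy production, to the cylinder probabilities.\<close>

lemma (in spin_law) entropy_production_ge_local_production:
  fixes W :: "'d site set"
  assumes "\<beta> \<ge> 0" "finite W" "0 \<in> W" "{y. nbr y 0} \<subseteq> W" "entropy_production \<beta> \<mu> = ereal s"
  shows "local_production \<beta> \<mu> 0 W \<le> s"
    and "\<zeta> \<in> configs W \<Longrightarrow> flux \<beta> \<mu> 0 W \<zeta> > 0 \<Longrightarrow> flux \<beta> \<mu> 0 W (flip 0 \<zeta>) > 0"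
proof -
  define P where "P = density \<mu> (\<lambda>\<omega>. ennreal (flip_rate \<beta> 0 \<omega>))"
  define Q where "Q = distr P (spin_space UNIV) (flip 0)"
  have sP: "sets P = sets (spin_space UNIV)" and sQ: "sets Q = sets (spin_space UNIV)"
    by (auto simp: P_def Q_def sets_spin)
  have spP: "space P = configs UNIV" by (simp add: P_def space_spin)
  have [measurable]: "flip 0 \<in> P \<rightarrow>\<^sub>M spin_space UNIV"
    using measurable_flip sP by (metis measurable_cong_sets)
  have "entropy_production \<beta> \<mu> = rel_entropy P Q"
    by (simp add: entropy_production_def P_def Q_def Let_def)
  with assms(5) have ac: "absolutely_continuous Q P" and int: "integrable P (entropy_density (exp 1) Q P)"
    and s: "KL_divergence (exp 1) Q P = s"
    by (auto simp: rel_entropy_def split: if_splits)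
  have P: "emeasure P (cylinder W \<zeta>) = ennreal (flux \<beta> \<mu> 0 W \<zeta>)" if "\<zeta> \<in> configs W" for \<zeta>
  proof -
    have "emeasure P (cylinder W \<zeta>) = (\<integral>\<^sup>+\<omega>. ennreal (flip_rate \<beta> 0 \<omega>) * indicator (cylinder W \<zeta>) \<omega> \<partial>\<mu>)"
      unfolding P_def using assms(2) by (intro emeasure_density) (auto intro: cylinder_sets)
    also have "\<dots> = (\<integral>\<^sup>+\<omega>. ennreal (flip_rate \<beta> 0 \<zeta>) * indicator (cylinder W \<zeta>) \<omega> \<partial>\<mu>)"
    proof (intro nn_integral_cong)
      fix \<omega>
      have "flip_rate \<beta> 0 \<omega> = flip_rate \<beta> 0 \<zeta>" if "\<omega> \<in> cylinder W \<zeta>"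
        unfolding flip_rate_def using that assms(3,4)
        by (intro arg_cong[where f = exp] arg_cong2[of _ _ _ _ times] sum.cong refl) (auto simp: cylinder_def)
      then show "ennreal (flip_rate \<beta> 0 \<omega>) * indicator (cylinder W \<zeta>) \<omega>
          = ennreal (flip_rate \<beta> 0 \<zeta>) * indicator (cylinder W \<zeta>) \<omega>"
        by (auto simp: indicator_def)
    qed
    also have "\<dots> = ennreal (flip_rate \<beta> 0 \<zeta>) * emeasure \<mu> (cylinder W \<zeta>)"
      using assms(2) by (intro nn_integral_cmult_indicator) (auto intro: cylinder_sets)
    also have "\<dots> = ennreal (flux \<beta> \<mu> 0 W \<zeta>)"
      by (simp add: emeasure_eq_measure flux_def cyl_def flip_rate_def ennreal_mult)
    finally show ?thesis .
  qed
  have Q: "emeasure Q (cylinder W \<zeta>) = ennreal (flux \<beta> \<mu> 0 W (flip 0 \<zeta>))" if "\<zeta> \<in> configs W" for \<zeta>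
  proof -
    have "flip 0 -` cylinder W \<zeta> \<inter> space P = cylinder W (flip 0 \<zeta>)"
    proof -
      have "flip 0 \<omega> x = \<zeta> x \<longleftrightarrow> \<omega> x = flip 0 \<zeta> x" for \<omega> x by (auto simp: flip_apply)
      then show ?thesis by (auto simp: cylinder_def spP intro: flip_configs)
    qed
    then have "emeasure Q (cylinder W \<zeta>) = emeasure P (cylinder W (flip 0 \<zeta>))"
      unfolding Q_def using assms(2) by (subst emeasure_distr) (auto intro: cylinder_measurable)
    then show ?thesis using P[of "flip 0 \<zeta>"] that assms(3) by auto
  qed
  have flux0: "flux \<beta> \<mu> 0 W \<zeta> \<ge> 0" for \<zeta> by (simp add: flux_def flip_rate_def cyl_nonneg)
  have finP: "finite_measure P"
  proof
    have "emeasure P (space P) = (\<Sum>\<zeta>\<in>configs W. emeasure P (cylinder W \<zeta>))"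
      using assms(2) sP cylinder_disjoint[of W]
      by (subst sum_emeasure) (auto simp: cylinder_UN spP intro: cylinder_measurable)
    also have "\<dots> = (\<Sum>\<zeta>\<in>configs W. ennreal (flux \<beta> \<mu> 0 W \<zeta>))"
      by (intro sum.cong P refl)
    also have "\<dots> \<noteq> \<infinity>" using assms(2) by simp
    finally show "emeasure P (space P) \<noteq> \<infinity>" .
  qed
  have finQ: "finite_measure Q"
    unfolding Q_def using finP by (rule finite_measure.finite_measure_distr) measurable
  have "local_production \<beta> \<mu> 0 W
      = (\<Sum>\<zeta>\<in>configs W. measure P (cylinder W \<zeta>) * ln (measure P (cylinder W \<zeta>) / measure Q (cylinder W \<zeta>)))"
    unfolding local_production_def by (intro sum.cong refl) (simp add: measure_def P Q flux0)
  also have "\<dots> \<le> KL_divergence (exp 1) Q P"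
    using assms(2) sP sQ cylinder_disjoint[of W]
    by (intro KL_divergence_ge_finite_partition finP finQ ac int) (auto simp: cylinder_UN spP intro: cylinder_measurable)
  finally show "local_production \<beta> \<mu> 0 W \<le> s" by (simp add: s)
  assume \<zeta>: "\<zeta> \<in> configs W" and "flux \<beta> \<mu> 0 W \<zeta> > 0"
  then have "emeasure P (cylinder W \<zeta>) \<noteq> 0" by (simp add: P)
  then have "emeasure Q (cylinder W \<zeta>) \<noteq> 0"
    using absolutely_continuousD[OF ac, of "cylinder W \<zeta>"] assms(2) sQ by (auto intro: cylinder_measurable)
  then show "flux \<beta> \<mu> 0 W (flip 0 \<zeta>) > 0"
    using flux0[of "flip 0 \<zeta>"] by (auto simp: Q[OF \<zeta>] less_le)
qed

lemma (in spin_law) marginal_eq_density: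
  assumes "finite \<Lambda>"
  shows "marginal \<Lambda> \<mu> = density (count_space (configs \<Lambda>)) (\<lambda>\<zeta>. ennreal (cyl \<mu> \<Lambda> \<zeta>))"
proof (rule measure_eqI_finite)
  have sets: "sets (spin_space \<Lambda>) = Pow (configs \<Lambda>)"
    unfolding spin_space_def configs_def using assms by (subst count_space_PiM_finite) auto
  then show "sets (marginal \<Lambda> \<mu>) = Pow (configs \<Lambda>)" by (simp add: marginal_def)
  show "finite (configs \<Lambda>)" using assms by simp
  fix \<zeta> assume \<zeta>: "\<zeta> \<in> configs \<Lambda>"
  have "(\<lambda>\<omega>. restrict \<omega> \<Lambda>) \<in> spin_space UNIV \<rightarrow>\<^sub>M spin_space \<Lambda>"
    unfolding spin_space_def by (rule measurable_restrict_subset) auto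
  then have "(\<lambda>\<omega>. restrict \<omega> \<Lambda>) \<in> \<mu> \<rightarrow>\<^sub>M spin_space \<Lambda>"
    using sets_spin by (metis measurable_cong_sets)
  then have "emeasure (marginal \<Lambda> \<mu>) {\<zeta>} = emeasure \<mu> ((\<lambda>\<omega>. restrict \<omega> \<Lambda>) -` {\<zeta>} \<inter> space \<mu>)"
    unfolding marginal_def using \<zeta> by (intro emeasure_distr) (auto simp: sets)
  also have "(\<lambda>\<omega>. restrict \<omega> \<Lambda>) -` {\<zeta>} \<inter> space \<mu> = cylinder \<Lambda> \<zeta>"
    using \<zeta> by (auto simp: cylinder_def space_spin configs_def PiE_iff extensional_def fun_eq_iff)
  also have "emeasure \<mu> (cylinder \<Lambda> \<zeta>) = ennreal (cyl \<mu> \<Lambda> \<zeta>)"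
    by (simp add: emeasure_eq_measure cyl_def)
  also have "\<dots> = emeasure (density (count_space (configs \<Lambda>)) (\<lambda>\<zeta>. ennreal (cyl \<mu> \<Lambda> \<zeta>))) {\<zeta>}"
    using \<zeta> by (simp add: emeasure_density nn_integral_count_space_indicator[symmetric]
      nn_integral_cmult_indicator)
  finally show "emeasure (marginal \<Lambda> \<mu>) {\<zeta>} = \<dots>" .
qed simp

lemma (in gibbs_pair) rel_entropy_marginal:
  assumes "finite \<Lambda>"
  shows "rel_entropy (marginal \<Lambda> \<mu>) (marginal \<Lambda> \<nu>) = ereal (relent \<mu> \<nu> \<Lambda>)"
proof -
  let ?C = "count_space (configs \<Lambda>)"
  interpret C: sigma_finite_measure ?C
    using assms by (intro sigma_finite_measure_count_space_finite) simp
  have "absolutely_continuous (marginal \<Lambda> \<nu>) (marginal \<Lambda> \<mu>)"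
    unfolding mu.marginal_eq_density[OF assms] nu.marginal_eq_density[OF assms]
      point_measure_def[symmetric]
    using nu_cyl_pos[OF assms] by (intro absolutely_continuousI_point_measure_finite)
      (force simp: not_le[symmetric] ennreal_eq_0_iff)
  moreover have "integrable (marginal \<Lambda> \<mu>) (entropy_density (exp 1) (marginal \<Lambda> \<nu>) (marginal \<Lambda> \<mu>))"
    unfolding mu.marginal_eq_density[OF assms]
    using assms by (subst integrable_real_density)
      (auto simp: mu.cyl_nonneg intro: integrable_count_space)
  moreover have "KL_divergence (exp 1) (marginal \<Lambda> \<nu>) (marginal \<Lambda> \<mu>) = relent \<mu> \<nu> \<Lambda>"
    unfolding mu.marginal_eq_density[OF assms] nu.marginal_eq_density[OF assms]
    using assms nu_cyl_pos[OF assms]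
    by (subst C.KL_density_density)
       (auto simp: mu.cyl_nonneg nu.cyl_nonneg lebesgue_integral_count_space_finite relent_def
         log_def AE_count_space less_le)
  ultimately show ?thesis by (simp add: rel_entropy_def)
qed

section \<open>Translation invariance\<close>

lemma measurable_translate [measurable]:
  "(\<lambda>\<omega> x. \<omega> (x + a)) \<in> spin_space UNIV \<rightarrow>\<^sub>M spin_space UNIV"
proof -
  have "(\<lambda>\<omega>. \<omega> (x + a)) \<in> spin_space UNIV \<rightarrow>\<^sub>M count_space {-1, 1::real}" for x
    by (rule measurable_coordinate)
  then show ?thesis
    unfolding spin_space_def[of UNIV]
    by (intro measurable_PiM_single') (auto simp: space_PiM PiE_iff)
qed

lemma tinv_measures_spin_law: "\<mu> \<in> tinv_measures \<Longrightarrow> spin_law \<mu>"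
  by (simp add: tinv_measures_def spin_law_def spin_law_axioms_def)

lemma cyl_translate:
  assumes "\<mu> \<in> tinv_measures" "finite W"
  shows "cyl \<mu> ((\<lambda>y. y + a) ` W) (\<lambda>y. \<zeta> (y - a)) = cyl \<mu> W \<zeta>"
proof -
  interpret spin_law \<mu> using assms(1) by (rule tinv_measures_spin_law)
  have "(\<lambda>\<omega> x. \<omega> (x + a)) \<in> \<mu> \<rightarrow>\<^sub>M spin_space UNIV"
    using measurable_translate sets_spin by (metis measurable_cong_sets)
  moreover have "distr \<mu> (spin_space UNIV) (\<lambda>\<omega> x. \<omega> (x + a)) = \<mu>"
    using assms(1) by (simp add: tinv_measures_def)
  ultimately have "cyl \<mu> W \<zeta> = measure \<mu> ((\<lambda>\<omega> x. \<omega> (x + a)) -` cylinder W \<zeta> \<inter> space \<mu>)"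
    unfolding cyl_def using assms(2) by (metis measure_distr cylinder_measurable)
  also have "(\<lambda>\<omega> x. \<omega> (x + a)) -` cylinder W \<zeta> \<inter> space \<mu> = cylinder ((\<lambda>y. y + a) ` W) (\<lambda>y. \<zeta> (y - a))"
    by (auto simp: cylinder_def space_spin configs_def PiE_iff)
  finally show ?thesis by (simp add: cyl_def)
qed

lemma mem_translate: "y \<in> (\<lambda>y. y + a) ` W \<longleftrightarrow> y - a \<in> W" for y a :: "'d::finite site"
  by (auto intro: image_eqI[of _ _ "y - a"])

lemma configs_translate:
  assumes "\<zeta> \<in> configs W" and "\<And>y. y \<in> W' \<longleftrightarrow> t y \<in> W"
  shows "(\<lambda>y. \<zeta> (t y)) \<in> configs W'"
  using assms unfolding configs_def PiE_iff extensional_def by simp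

lemma sum_configs_translate:
  fixes W :: "'d::finite site set" and G :: "'d config \<Rightarrow> 'b::comm_monoid_add"
  shows "(\<Sum>\<zeta>\<in>configs ((\<lambda>y. y + a) ` W). G \<zeta>) = (\<Sum>\<zeta>\<in>configs W. G (\<lambda>y. \<zeta> (y - a)))"
proof -
  have "(\<lambda>y. \<zeta> (y - a)) \<in> configs ((\<lambda>y. y + a) ` W)" if "\<zeta> \<in> configs W" for \<zeta> :: "'d config"
    using that by (rule configs_translate) (rule mem_translate)
  moreover have "(\<lambda>y. \<zeta> (y + a)) \<in> configs W" if "\<zeta> \<in> configs ((\<lambda>y. y + a) ` W)" for \<zeta> :: "'d config"
    using that by (rule configs_translate) (simp add: mem_translate)
  ultimately show ?thesis
    by (intro sum.reindex_bij_witness[of _ "\<lambda>\<zeta> y. \<zeta> (y - a)" "\<lambda>\<zeta> y. \<zeta> (y + a)"]) auto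
qed

lemma relent_translate:
  assumes "\<mu> \<in> tinv_measures" "\<nu> \<in> tinv_measures" "finite W"
  shows "relent \<mu> \<nu> ((\<lambda>y. y + a) ` W) = relent \<mu> \<nu> W"
  unfolding relent_def sum_configs_translate using assms by (simp add: cyl_translate)

lemma flux_translate:
  assumes "\<mu> \<in> tinv_measures" "finite W"
  shows "flux \<beta> \<mu> (x + a) ((\<lambda>y. y + a) ` W) (\<lambda>y. \<zeta> (y - a)) = flux \<beta> \<mu> x W \<zeta>"
proof -
  have "(\<Sum>y\<in>{y. nbr y (x + a)}. \<zeta> x * \<zeta> (y - a)) = (\<Sum>y\<in>{y. nbr y x}. \<zeta> x * \<zeta> y)"
    by (rule sum.reindex_bij_witness[of _ "\<lambda>y. y + a" "\<lambda>y. y - a"]) (auto simp: nbr_def algebra_simps)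
  then show ?thesis using assms by (simp add: flux_def cyl_translate flip_rate_def)
qed

lemma flip_translate: "flip (x + a) (\<lambda>y. \<zeta> (y - a)) = (\<lambda>y. flip x \<zeta> (y - a))"
  by (auto simp: flip_apply fun_eq_iff diff_eq_eq)

lemma local_production_translate:
  assumes "\<mu> \<in> tinv_measures" "finite W"
  shows "local_production \<beta> \<mu> (x + a) ((\<lambda>y. y + a) ` W) = local_production \<beta> \<mu> x W"
  unfolding local_production_def sum_configs_translate flip_translate flux_translate[OF assms] ..

lemma local_production_le:
  fixes x :: "'d::finite site"
  assumes "\<mu> \<in> tinv_measures" "\<beta> \<ge> 0" "finite W" "x \<in> W" "{y. nbr y x} \<subseteq> W"
    and "entropy_production \<beta> \<mu> = ereal s"
  shows "local_production \<beta> \<mu> x W \<le> s"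
    and "\<zeta> \<in> configs W \<Longrightarrow> flux \<beta> \<mu> x W \<zeta> > 0 \<Longrightarrow> flux \<beta> \<mu> x W (flip x \<zeta>) > 0"
proof -
  interpret spin_law \<mu> using assms(1) by (rule tinv_measures_spin_law)
  let ?W = "(\<lambda>y. y - x) ` W"
  have 0: "0 \<in> ?W" using assms(4) by force
  have N: "{y. nbr y 0} \<subseteq> ?W"
  proof
    fix y :: "'d site" assume "y \<in> {y. nbr y 0}"
    then have "nbr (y + x) x" by (simp add: nbr_def)
    then show "y \<in> ?W" using assms(5) by (intro image_eqI[of _ _ "y + x"]) auto
  qed
  have W: "(\<lambda>y. y + x) ` ?W = W" by (auto simp: image_image)
  have fin: "finite ?W" using assms(3) by simp
  note E = entropy_production_ge_local_production[OF assms(2) fin 0 N assms(6)]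
  show "local_production \<beta> \<mu> x W \<le> s"
    using E(1) local_production_translate[OF assms(1) fin, of \<beta> 0 x] by (simp add: W)
  assume \<zeta>: "\<zeta> \<in> configs W" and f: "flux \<beta> \<mu> x W \<zeta> > 0"
  have tr: "flux \<beta> \<mu> x W \<zeta> = flux \<beta> \<mu> 0 ?W (\<lambda>y. \<zeta> (y + x))" for \<zeta>
    using flux_translate[OF assms(1) fin, of \<beta> 0 x "\<lambda>y. \<zeta> (y + x)"] by (simp add: W)
  have "(\<lambda>y. \<zeta> (y + x)) \<in> configs ?W"
    using \<zeta> by (rule configs_translate) (simp add: mem_translate[of _ "- x", simplified])
  then have "flux \<beta> \<mu> 0 ?W (flip 0 (\<lambda>y. \<zeta> (y + x))) > 0" using E(2) f tr by simp
  also have "flip 0 (\<lambda>y. \<zeta> (y + x)) = (\<lambda>y. flip x \<zeta> (y + x))" by (auto simp: flip_apply)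
  finally show "flux \<beta> \<mu> x W (flip x \<zeta>) > 0" by (simp add: tr)
qed

lemma card_boundary_edges_translate:
  "card (boundary_edges ((\<lambda>y. y + a) ` T)) = card (boundary_edges T)"
proof -
  have "bij_betw (\<lambda>(x, y). (x + a, y + a)) (boundary_edges T) (boundary_edges ((\<lambda>y. y + a) ` T))"
    by (rule bij_betw_byWitness[where f' = "\<lambda>(x, y). (x - a, y - a)"])
       (auto simp: boundary_edges_def nbr_def image_iff algebra_simps)
  then show ?thesis using bij_betw_same_card by fastforce
qed

section \<open>Tilings of boxes\<close>

definition grid_point :: "nat \<Rightarrow> 'd::finite site \<Rightarrow> 'd site" where
  "grid_point L a = (\<chi> i. int L * a $ i)"

definition tile :: "nat \<Rightarrow> nat \<Rightarrow> 'd::finite site \<Rightarrow> 'd site set" where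
  "tile L r a = (\<lambda>y. y + grid_point L a) ` lattice_box r"

lemma mem_tile: "y \<in> tile L r a \<longleftrightarrow> (\<forall>i. \<bar>y $ i - int L * a $ i\<bar> \<le> int r)"
proof -
  have "y \<in> tile L r a \<longleftrightarrow> y - grid_point L a \<in> lattice_box r"
    unfolding tile_def by (rule mem_translate)
  moreover have "- int r \<le> z \<and> z \<le> int r \<longleftrightarrow> \<bar>z\<bar> \<le> int r" for z by auto
  ultimately show ?thesis by (simp add: lattice_box_def grid_point_def)
qed

lemma finite_tile [simp]: "finite (tile L r a)"
  by (simp add: tile_def)

lemma card_tile [simp]: "card (tile L r (a :: 'd::finite site)) = (2 * r + 1) ^ CARD('d)"
  unfolding tile_def by (subst card_image) (auto simp: card_lattice_box inj_on_def)

lemma tile_disjoint: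
  assumes "a \<noteq> a'" "2 * r < L"
  shows "tile L r a \<inter> tile L r a' = {}"
proof (rule ccontr)
  assume "tile L r a \<inter> tile L r a' \<noteq> {}"
  then obtain y where "y \<in> tile L r a" "y \<in> tile L r a'" by blast
  then have y: "\<bar>y $ i - int L * a $ i\<bar> \<le> int r" "\<bar>y $ i - int L * a' $ i\<bar> \<le> int r" for i
    by (simp_all add: mem_tile)
  have "a $ i = a' $ i" for i
  proof (rule ccontr)
    assume "a $ i \<noteq> a' $ i"
    then have "int L * 1 \<le> int L * \<bar>a $ i - a' $ i\<bar>" by (intro mult_left_mono) auto
    also have "\<dots> = \<bar>int L * a $ i - int L * a' $ i\<bar>" by (simp add: abs_mult flip: right_diff_distrib)
    also have "\<dots> \<le> 2 * int r" using y[of i] by linarith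
    finally show False using assms(2) by simp
  qed
  then show False using assms(1) by (simp add: vec_eq_iff)
qed

text \<open>Boxes have odd side length \<open>2 * n + 1\<close>, so division with remainder, applied to each coordinate shifted
by \<open>n\<close>, splits a box of radius \<open>k * (2 * n + 1) + n\<close> exactly into translates of the box of
radius \<open>n\<close>.\<close>

lemma tiles_cover: "(\<Union>a\<in>lattice_box k. tile (2 * n + 1) n a) = lattice_box (k * (2 * n + 1) + n)"
proof (intro set_eqI iffI)
  fix y :: "'a site"
  assume "y \<in> (\<Union>a\<in>lattice_box k. tile (2 * n + 1) n a)"
  then obtain a where "a \<in> lattice_box k" "y \<in> tile (2 * n + 1) n a" by blast
  then have a: "- int k \<le> a $ i" "a $ i \<le> int k"
    and y: "\<bar>y $ i - int (2 * n + 1) * a $ i\<bar> \<le> int n" for i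
    by (simp_all add: mem_tile lattice_box_def)
  have "int (2 * n + 1) * (- int k) \<le> int (2 * n + 1) * a $ i" for i by (intro mult_left_mono a) auto
  moreover have "int (2 * n + 1) * a $ i \<le> int (2 * n + 1) * int k" for i by (intro mult_left_mono a) auto
  moreover have "int (k * (2 * n + 1) + n) = int (2 * n + 1) * int k + int n"
    by (simp add: algebra_simps)
  ultimately have "- int (k * (2 * n + 1) + n) \<le> y $ i \<and> y $ i \<le> int (k * (2 * n + 1) + n)" for i
    using y[of i] unfolding mult_minus_right by (smt (verit))
  then show "y \<in> lattice_box (k * (2 * n + 1) + n)" by (simp add: lattice_box_def)
next
  fix y :: "'a site"
  assume y: "y \<in> lattice_box (k * (2 * n + 1) + n)"
  let ?L = "int (2 * n + 1)"
  define a :: "'a site" where "a = (\<chi> i. (y $ i + int n) div ?L)"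
  have L: "?L > 0" by simp
  have "- int k \<le> a $ i \<and> a $ i \<le> int k \<and> \<bar>y $ i - ?L * a $ i\<bar> \<le> int n" for i
  proof -
    have b: "- (int k * ?L) - int n \<le> y $ i" "y $ i \<le> int k * ?L + int n"
      using y by (auto simp: lattice_box_def algebra_simps)
    have "(- int k * ?L) div ?L \<le> (y $ i + int n) div ?L"
      using b by (intro zdiv_mono1 L) simp
    moreover have "(y $ i + int n) div ?L \<le> (int k * ?L + 2 * int n) div ?L"
      using b by (intro zdiv_mono1 L) simp
    moreover have "(- int k * ?L) div ?L = - int k" by (rule nonzero_mult_div_cancel_right) simp
    moreover have "(int k * ?L + 2 * int n) div ?L = int k"
      by (subst div_mult_self3) (auto simp: div_pos_pos_trivial)
    moreover have "y $ i + int n = ?L * ((y $ i + int n) div ?L) + (y $ i + int n) mod ?L"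
      by simp
    moreover have "0 \<le> (y $ i + int n) mod ?L" "(y $ i + int n) mod ?L < ?L"
      by (auto intro: pos_mod_bound pos_mod_sign L)
    ultimately show ?thesis unfolding a_def vec_lambda_beta by linarith
  qed
  then have "a \<in> lattice_box k" "y \<in> tile (2 * n + 1) n a"
    by (auto simp: lattice_box_def mem_tile)
  then show "y \<in> (\<Union>a\<in>lattice_box k. tile (2 * n + 1) n a)" by blast
qed

lemma boundary_edges_tile:
  assumes "(x, y) \<in> boundary_edges (tile L r a)"
  shows "y \<in> tile L (Suc r) a" and "y \<notin> tile L r a"
proof -
  from assms have x: "x \<in> tile L r a" and n: "nbr x y" and y: "y \<notin> tile L r a"
    by (auto simp: boundary_edges_def)
  show "y \<notin> tile L r a" by fact
  have "\<bar>y $ i - int L * a $ i\<bar> \<le> int (Suc r)" for i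
  proof -
    have "\<bar>x $ i - int L * a $ i\<bar> \<le> int r" using x by (simp add: mem_tile)
    then show ?thesis using nbr_coord[OF n, of i] by linarith
  qed
  then show "y \<in> tile L (Suc r) a" by (simp add: mem_tile)
qed

lemma lattice_box_mono: "m \<le> n \<Longrightarrow> lattice_box m \<subseteq> lattice_box n"
  unfolding lattice_box_def
  by (auto intro: order.trans[of "- int n" "- int m"] order.trans[of _ "int m"])

lemma card_boundary_edges_le:
  fixes T :: "'d::finite site set"
  assumes "finite T"
  shows "card (boundary_edges T) \<le> card T * card {y :: 'd site. nbr y 0}"
  unfolding card_edges[OF assms, symmetric]
  using assms by (intro card_mono) (auto simp: boundary_edges_def)

lemma card_boundary_edges_lattice_box:
  "card (boundary_edges (lattice_box (Suc n) :: 'd::finite site set))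
     \<le> ((2 * Suc n + 1) ^ CARD('d) - (2 * n + 1) ^ CARD('d)) * card {y :: 'd site. nbr y 0}"
proof -
  let ?S = "lattice_box (Suc n) - lattice_box n :: 'd site set"
  have "boundary_edges (lattice_box (Suc n)) \<subseteq> {(x, y :: 'd site). x \<in> ?S \<and> nbr x y}"
  proof
    fix p assume "p \<in> boundary_edges (lattice_box (Suc n) :: 'd site set)"
    then obtain x y where p: "p = (x, y)" and x: "x \<in> lattice_box (Suc n)"
      and y: "y \<notin> lattice_box (Suc n)" and n: "nbr x y"
      by (auto simp: boundary_edges_def)
    have "x \<notin> lattice_box n"
    proof
      assume "x \<in> lattice_box n"
      then have "- int (Suc n) \<le> y $ i \<and> y $ i \<le> int (Suc n)" for i
        using nbr_coord[OF n, of i] unfolding lattice_box_def by (smt (verit) mem_Collect_eq of_nat_Suc)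
      with y show False by (simp add: lattice_box_def)
    qed
    with x n p show "p \<in> {(x, y). x \<in> ?S \<and> nbr x y}" by simp
  qed
  then have "card (boundary_edges (lattice_box (Suc n) :: 'd site set)) \<le> card {(x, y :: 'd site). x \<in> ?S \<and> nbr x y}"
    by (intro card_mono finite_edges) auto
  also have "\<dots> = card ?S * card {y :: 'd site. nbr y 0}" by (intro card_edges) auto
  also have "card ?S = (2 * Suc n + 1) ^ CARD('d) - (2 * n + 1) ^ CARD('d)"
    using lattice_box_mono[of n "Suc n", where 'a = 'd]
    by (subst card_Diff_subset) (auto simp: card_lattice_box)
  finally show ?thesis .
qed

section \<open>Relative entropy of large boxes\<close>

context gibbs_pair
begin

lemma relent_empty: "relent \<mu> \<nu> {} = 0"
  using mu.prob_space nu.prob_space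
  by (simp add: relent_def cyl_def cylinder_def flip: mu.space_spin) (simp add: mu.space_spin flip: nu.space_spin)

lemma relent_le_card:
  assumes "finite S"
  shows "relent \<mu> \<nu> S \<le> card S * site_cost TYPE('d) \<beta>"
  using assms
proof induction
  case (insert x S)
  then show ?case using relent_insert_le[of S x] by (simp add: algebra_simps)
qed (simp add: relent_empty)

lemma relent_Union_ge:
  assumes "finite I" "\<And>i. i \<in> I \<Longrightarrow> finite (T i)" "disjoint_family_on T I"
  shows "(\<Sum>i\<in>I. relent \<mu> \<nu> (T i) - 8 * \<beta> * card (boundary_edges (T i))) \<le> relent \<mu> \<nu> (\<Union>i\<in>I. T i)"
  using assms
proof induction
  case (insert i I)
  then have "(\<Union>i\<in>I. T i) \<inter> T i = {}" "disjoint_family_on T I"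
    by (auto simp: disjoint_family_on_insert)
  then show ?case
    using insert relent_superadditive[of "\<Union>i\<in>I. T i" "T i"] by (simp add: Un_commute)
qed (simp add: relent_empty)

end

text \<open>The constant of \<open>relent_tile_le\<close> for a region of \<open>k\<close> sites.\<close>

definition tile_cost :: "'d::finite itself \<Rightarrow> real \<Rightarrow> nat \<Rightarrow> real" where
  "tile_cost _ \<beta> k = 2 * k\<^sup>2 * rate_bound TYPE('d) \<beta> ^ 3 / (weight_bound TYPE('d) \<beta> k)\<^sup>2"

definition box_volume :: "'d::finite itself \<Rightarrow> nat \<Rightarrow> real" where
  "box_volume _ n = real (card (lattice_box n :: 'd site set))"

lemma card_lattice_box_eq_volume: "real (card (lattice_box n :: 'd::finite site set)) = box_volume TYPE('d) n"
  by (simp add: box_volume_def)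

definition surface_cost :: "'d::finite itself \<Rightarrow> real \<Rightarrow> real" where
  "surface_cost _ \<beta> = 8 * \<beta> * card {y :: 'd site. nbr y 0}"

lemma box_volume_eq: "box_volume TYPE('d::finite) n = (2 * real n + 1) ^ CARD('d)"
  by (simp add: box_volume_def card_lattice_box add.commute)

lemma box_volume_pos: "box_volume TYPE('d::finite) n > 0"
  by (simp add: box_volume_eq)

lemma box_volume_mono: "m \<le> n \<Longrightarrow> box_volume TYPE('d::finite) m \<le> box_volume TYPE('d) n"
  unfolding box_volume_eq by (intro power_mono) auto

lemma box_volume_mult: "box_volume TYPE('d) (k * (2 * n + 1) + n) = box_volume TYPE('d::finite) k * box_volume TYPE('d) n"
  by (simp add: box_volume_eq algebra_simps flip: power_mult_distrib)

lemma lattice_box_ratio_tendsto: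
  "(\<lambda>N. box_volume TYPE('d::finite) (N - c) / box_volume TYPE('d) N) \<longlonglongrightarrow> 1"
proof -
  have "(\<lambda>N. 2 * real c / real (2 * N + 1)) \<longlonglongrightarrow> 0"
    by (rule LIMSEQ_subseq_LIMSEQ[OF lim_const_over_n, of "\<lambda>N. 2 * N + 1", unfolded o_def])
       (auto intro: strict_monoI)
  then have "(\<lambda>N. (1 - 2 * real c / real (2 * N + 1)) ^ CARD('d)) \<longlonglongrightarrow> (1 - 0) ^ CARD('d)"
    by (intro tendsto_intros)
  moreover have "\<forall>\<^sub>F N in sequentially. (1 - 2 * real c / real (2 * N + 1)) ^ CARD('d) = box_volume TYPE('d) (N - c) / box_volume TYPE('d) N"
    using eventually_ge_at_top[of c]
  proof eventually_elim
    case (elim N)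
    then have "1 - 2 * real c / real (2 * N + 1) = (2 * real (N - c) + 1) / (2 * real N + 1)"
      by (simp add: field_simps of_nat_diff)
    then show ?case by (simp add: box_volume_eq power_divide)
  qed
  ultimately show ?thesis by (simp add: tendsto_cong)
qed

locale tinv_gibbs_pair = gibbs_pair \<mu> \<nu> \<beta>
  for \<mu> \<nu> :: "'d::finite config measure" and \<beta> +
  assumes mu_tinv: "\<mu> \<in> tinv_measures" and nu_tinv: "\<nu> \<in> tinv_measures"
begin

lemma relent_Un_tiles_le:
  assumes s: "entropy_production \<beta> \<mu> = ereal s"
    and "finite R" "finite I" "\<And>i. i \<in> I \<Longrightarrow> finite (T i)" "disjoint_family_on T I"
    and "\<And>i. i \<in> I \<Longrightarrow> R \<inter> T i = {}" "\<And>i. i \<in> I \<Longrightarrow> card (T i) = k"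
    and "\<And>i x y. i \<in> I \<Longrightarrow> (x, y) \<in> boundary_edges (T i) \<Longrightarrow> y \<in> R"
  shows "relent \<mu> \<nu> (R \<union> (\<Union>i\<in>I. T i)) \<le> relent \<mu> \<nu> R + card I * (tile_cost TYPE('d) \<beta> k * s)"
  using assms(3-)
proof induction
  case (insert i I)
  let ?R = "R \<union> (\<Union>i\<in>I. T i)"
  have d: "?R \<inter> T i = {}" and d': "disjoint_family_on T I"
    using insert by (auto simp: disjoint_family_on_insert)
  have fin: "finite ?R" "finite (T i)" using assms(2) insert by auto
  have nb: "y \<in> ?R" if "(x, y) \<in> boundary_edges (T i)" for x y
    using that insert.prems(5)[of i x y] by auto
  have W: "x \<in> ?R \<union> T i" "{y. nbr y x} \<subseteq> ?R \<union> T i" if "x \<in> T i" for x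
    using that nb[of x] nbr_sym[of x] by (auto simp: boundary_edges_def)
  have finW: "finite (?R \<union> T i)" using fin by auto
  have "relent \<mu> \<nu> (?R \<union> T i) \<le> relent \<mu> \<nu> ?R
      + 2 * (card (T i))\<^sup>2 * rate_bound TYPE('d) \<beta> ^ 3 / (weight_bound TYPE('d) \<beta> (card (T i)))\<^sup>2 * s"
    using local_production_le[OF mu_tinv beta_nonneg finW W s]
    by (intro relent_tile_le fin d nb) auto
  then have "relent \<mu> \<nu> (?R \<union> T i) \<le> relent \<mu> \<nu> ?R + tile_cost TYPE('d) \<beta> k * s"
    using insert.prems(4)[of i] by (simp add: tile_cost_def)
  moreover have "relent \<mu> \<nu> ?R \<le> relent \<mu> \<nu> R + card I * (tile_cost TYPE('d) \<beta> k * s)"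
    by (rule insert.IH; use insert.prems d' in blast)
  moreover have "R \<union> (\<Union>i\<in>insert i I. T i) = ?R \<union> T i" by auto
  ultimately show ?case using insert.hyps by (simp add: algebra_simps)
qed simp

abbreviation box_relent :: "nat \<Rightarrow> real" where
  "box_relent n \<equiv> relent \<mu> \<nu> (lattice_box n)"

lemma relent_tile: "relent \<mu> \<nu> (tile L r a) = box_relent r"
  unfolding tile_def by (intro relent_translate mu_tinv nu_tinv) simp

lemma card_boundary_edges_tile:
  "card (boundary_edges (tile L r a)) = card (boundary_edges (lattice_box r :: 'd site set))" for a :: "'d site"
  unfolding tile_def by (rule card_boundary_edges_translate)

text \<open>The box of radius \<open>N\<close> contains the exactly tiled box of radius \<open>M\<close>. Superadditivity is applied to the
tiles, each of which costs a surface term, and to the remaining sites, whose number bounds their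
surface.\<close>

lemma box_relent_ge:
  fixes r k :: nat
  defines "n \<equiv> Suc r"
  defines "M \<equiv> k * (2 * n + 1) + n"
  assumes "M \<le> N"
  shows "box_volume TYPE('d) k * (box_relent n - surface_cost TYPE('d) \<beta> * (box_volume TYPE('d) n - box_volume TYPE('d) r)) - surface_cost TYPE('d) \<beta> * (box_volume TYPE('d) N - box_volume TYPE('d) M) \<le> box_relent N"
proof -
  let ?T = "tile (2 * n + 1) n :: 'd site \<Rightarrow> 'd site set" and ?I = "lattice_box k :: 'd site set"
  have c: "real (card (boundary_edges (lattice_box n :: 'd site set))) * (8 * \<beta>) \<le> surface_cost TYPE('d) \<beta> * (box_volume TYPE('d) n - box_volume TYPE('d) r)"
  proof -
    have "card (boundary_edges (lattice_box n :: 'd site set))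
        \<le> (card (lattice_box n :: 'd site set) - card (lattice_box r :: 'd site set)) * card {y :: 'd site. nbr y 0}"
      using card_boundary_edges_lattice_box[of r, where 'd = 'd] by (simp add: n_def card_lattice_box)
    then have "real (card (boundary_edges (lattice_box n :: 'd site set)))
        \<le> real ((card (lattice_box n :: 'd site set) - card (lattice_box r :: 'd site set)) * card {y :: 'd site. nbr y 0})"
      by (rule of_nat_mono)
    also have "\<dots> = (box_volume TYPE('d) n - box_volume TYPE('d) r) * card {y :: 'd site. nbr y 0}"
      using card_mono[OF finite_lattice_box lattice_box_mono[of r n, where 'a = 'd]]
      by (simp add: n_def of_nat_diff card_lattice_box_eq_volume)
    finally show ?thesis
      using beta_pos unfolding surface_cost_def by (simp add: mult.commute mult.left_commute)
  qed
  have disj: "disjoint_family_on ?T ?I"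
    unfolding disjoint_family_on_def by (intro ballI impI tile_disjoint) auto
  have "box_volume TYPE('d) k * (box_relent n - surface_cost TYPE('d) \<beta> * (box_volume TYPE('d) n - box_volume TYPE('d) r))
      \<le> box_volume TYPE('d) k * (box_relent n - 8 * \<beta> * card (boundary_edges (lattice_box n :: 'd site set)))"
    using c box_volume_pos[of k, where 'd = 'd] by (intro mult_left_mono) (auto simp: algebra_simps)
  also have "\<dots> = (\<Sum>a\<in>?I. relent \<mu> \<nu> (?T a) - 8 * \<beta> * card (boundary_edges (?T a)))"
    by (simp add: relent_tile card_boundary_edges_tile card_lattice_box_eq_volume)
  also have "\<dots> \<le> relent \<mu> \<nu> (\<Union>a\<in>?I. ?T a)"
    using disj by (intro relent_Union_ge) auto
  also have "\<dots> = box_relent M" by (simp only: tiles_cover M_def)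
  finally have M: "box_volume TYPE('d) k * (box_relent n - surface_cost TYPE('d) \<beta> * (box_volume TYPE('d) n - box_volume TYPE('d) r)) \<le> box_relent M" .
  let ?S = "lattice_box N - lattice_box M :: 'd site set"
  have cS: "real (card ?S) = box_volume TYPE('d) N - box_volume TYPE('d) M"
    using lattice_box_mono[OF assms(3), where 'a = 'd] box_volume_mono[OF assms(3)]
    by (subst card_Diff_subset) (auto simp: of_nat_diff card_mono card_lattice_box_eq_volume)
  have "real (card (boundary_edges ?S)) \<le> real (card ?S * card {y :: 'd site. nbr y 0})"
    by (intro of_nat_mono card_boundary_edges_le) simp
  then have "8 * \<beta> * card (boundary_edges ?S) \<le> 8 * \<beta> * (card ?S * card {y :: 'd site. nbr y 0})"
    using beta_pos by (intro mult_left_mono) auto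
  also have "\<dots> = surface_cost TYPE('d) \<beta> * (box_volume TYPE('d) N - box_volume TYPE('d) M)" unfolding of_nat_mult cS surface_cost_def by simp
  finally have S: "8 * \<beta> * card (boundary_edges ?S) \<le> surface_cost TYPE('d) \<beta> * (box_volume TYPE('d) N - box_volume TYPE('d) M)" .
  have "lattice_box M \<union> ?S = lattice_box N" using lattice_box_mono[OF assms(3), where 'a = 'd] by auto
  moreover have "box_relent M + relent \<mu> \<nu> ?S - 8 * \<beta> * card (boundary_edges ?S) \<le> relent \<mu> \<nu> (lattice_box M \<union> ?S)"
    by (intro relent_superadditive) auto
  moreover have "relent \<mu> \<nu> ?S \<ge> 0" by (intro relent_nonneg) simp
  ultimately show ?thesis using M S by simp
qed

text \<open>Each tile of radius \<open>n\<close> is shrunk by one layer to radius \<open>r\<close>. The removed layers form corridors that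
contain the outer boundaries of all shrunk tiles. The corridor sites are revealed first, at the cost
\<open>site_cost\<close> each, and then the shrunk tiles, at the cost \<open>tile_cost\<close> each.\<close>

lemma box_relent_le:
  fixes r k :: nat
  defines "n \<equiv> Suc r"
  assumes s: "entropy_production \<beta> \<mu> = ereal s"
  shows "box_relent (k * (2 * n + 1) + n)
    \<le> box_volume TYPE('d) k * ((box_volume TYPE('d) n - box_volume TYPE('d) r) * site_cost TYPE('d) \<beta> + tile_cost TYPE('d) \<beta> ((2 * r + 1) ^ CARD('d)) * s)"
proof -
  let ?L = "2 * n + 1" and ?I = "lattice_box k :: 'd site set"
  let ?M = "k * (2 * n + 1) + n"
  let ?T = "tile ?L r :: 'd site \<Rightarrow> 'd site set" and ?U = "tile ?L n :: 'd site \<Rightarrow> 'd site set"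
  let ?K = "tile_cost TYPE('d) \<beta> ((2 * r + 1) ^ CARD('d))"
  \<comment> \<open>The corridors. They include the layer next to the surface of the large box.\<close>
  define R :: "'d site set" where "R = lattice_box ?M - (\<Union>a\<in>?I. ?T a)"
  have TU: "?T a \<subseteq> ?U a" for a
  proof
    fix y assume "y \<in> ?T a"
    then have "\<bar>y $ i - int ?L * a $ i\<bar> \<le> int r" for i unfolding mem_tile by blast
    then have "\<bar>y $ i - int ?L * a $ i\<bar> \<le> int n" for i
      by (rule order.trans) (simp add: n_def)
    then show "y \<in> ?U a" unfolding mem_tile by blast
  qed
  have UM: "?U a \<subseteq> lattice_box ?M" if "a \<in> ?I" for a
    using that unfolding tiles_cover[symmetric] by blast
  have disjU: "?U a \<inter> ?U a' = {}" if "a \<noteq> a'" for a a'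
    using that by (intro tile_disjoint) auto
  have disj: "disjoint_family_on ?T ?I"
    unfolding disjoint_family_on_def using disjU TU by blast
  have nb: "y \<in> R" if a: "a \<in> ?I" and "(x, y) \<in> boundary_edges (?T a)" for a x y
  proof -
    have y: "y \<in> ?U a" "y \<notin> ?T a" using boundary_edges_tile[OF that(2)] by (auto simp: n_def)
    then have "y \<notin> ?T a'" for a' using disjU[of a a'] TU[of a'] by (cases "a = a'") auto
    then show ?thesis using y UM[OF a] by (auto simp: R_def)
  qed
  have "card (\<Union>a\<in>?I. ?T a) = (\<Sum>a\<in>?I. card (?T a))"
    using disj by (intro card_UN_disjoint') auto
  then have cT: "real (card (\<Union>a\<in>?I. ?T a)) = box_volume TYPE('d) k * box_volume TYPE('d) r"
    by (simp add: box_volume_def card_lattice_box)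
  have sub: "(\<Union>a\<in>?I. ?T a) \<subseteq> lattice_box ?M" using TU UM by blast
  have "real (card R) = box_volume TYPE('d) ?M - box_volume TYPE('d) k * box_volume TYPE('d) r"
    unfolding R_def using sub
    by (subst card_Diff_subset) (auto simp: of_nat_diff card_mono cT[symmetric] card_lattice_box_eq_volume intro: finite_subset)
  then have cR: "real (card R) = box_volume TYPE('d) k * (box_volume TYPE('d) n - box_volume TYPE('d) r)"
    unfolding box_volume_mult by (simp add: right_diff_distrib)
  have "R \<union> (\<Union>a\<in>?I. ?T a) = lattice_box ?M" using sub by (auto simp: R_def)
  moreover have "relent \<mu> \<nu> (R \<union> (\<Union>a\<in>?I. ?T a)) \<le> relent \<mu> \<nu> R + card ?I * (?K * s)"
    using nb by (intro relent_Un_tiles_le s disj) (auto simp: R_def)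
  moreover have "relent \<mu> \<nu> R \<le> card R * site_cost TYPE('d) \<beta>"
    by (intro relent_le_card) (simp add: R_def)
  ultimately show ?thesis unfolding cR card_lattice_box_eq_volume by (simp add: algebra_simps)
qed

end

section \<open>The relative entropy density\<close>

text \<open>A variant of Fekete's lemma. For fixed \<open>n\<close>, letting \<open>N\<close> tend to infinity shows that no value
\<open>u (Suc n)\<close> exceeds the limes inferior of \<open>u\<close> by more than the vanishing error \<open>e n\<close>.\<close>

lemma convergent_of_almost_monotone:
  fixes u e :: "nat \<Rightarrow> real" and \<rho> :: "nat \<Rightarrow> nat \<Rightarrow> real"
  assumes "\<And>n. 0 \<le> u n" "\<And>n. u n \<le> C" "e \<longlonglongrightarrow> 0" "\<And>n. \<rho> n \<longlonglongrightarrow> 1"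
    and "\<And>n. \<forall>\<^sub>F N in sequentially. \<rho> n N * (u (Suc n) - e n) - c * (1 - \<rho> n N) \<le> u N"
  shows "convergent u"
proof -
  have le: "ereal (u (Suc n) - e n) \<le> liminf u" for n
  proof -
    have "(\<lambda>N. \<rho> n N * (u (Suc n) - e n) - c * (1 - \<rho> n N)) \<longlonglongrightarrow> 1 * (u (Suc n) - e n) - c * (1 - 1)"
      by (intro tendsto_intros assms)
    then have *: "(\<lambda>N. ereal (\<rho> n N * (u (Suc n) - e n) - c * (1 - \<rho> n N))) \<longlonglongrightarrow> ereal (u (Suc n) - e n)"
      by simp
    have "ereal (u (Suc n) - e n) = liminf (\<lambda>N. ereal (\<rho> n N * (u (Suc n) - e n) - c * (1 - \<rho> n N)))"
      by (rule lim_imp_Liminf[OF sequentially_bot *, symmetric])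
    also have "\<dots> \<le> liminf u" using assms(5)[of n] by (intro Liminf_mono) simp
    finally show ?thesis .
  qed
  have "0 \<le> liminf u" using assms(1) by (intro Liminf_bounded) simp
  moreover have "liminf u \<le> ereal C"
    using assms(2) by (intro order.trans[OF Liminf_le_Limsup] Limsup_bounded) auto
  ultimately obtain l where l: "liminf u = ereal l" by (cases "liminf u") auto
  have "(\<lambda>n. ereal (l + e n)) \<longlonglongrightarrow> ereal (l + 0)"
    by (intro tendsto_intros assms)
  from lim_imp_Limsup[OF sequentially_bot this]
  have lim: "limsup (\<lambda>n. ereal (l + e n)) = ereal l" by simp
  have "limsup u = limsup (\<lambda>n. ereal (u (Suc n)))" using limsup_shift[of "\<lambda>n. ereal (u n)"] by simp
  also have "\<dots> \<le> limsup (\<lambda>n. ereal (l + e n))"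
    using le unfolding l by (intro Limsup_mono) (auto simp: algebra_simps)
  finally have "limsup u \<le> l" by (simp add: lim)
  then have "u \<longlonglongrightarrow> l" by (rule limsup_le_liminf_real) (simp add: l)
  then show ?thesis by (rule convergentI)
qed

context tinv_gibbs_pair
begin

lemma box_relent_density_convergent: "convergent (\<lambda>n. box_relent n / box_volume TYPE('d) n)"
proof -
  define \<rho> where "\<rho> r N = (let n = Suc r in box_volume TYPE('d) ((N - n) div (2 * n + 1) * (2 * n + 1) + n) / box_volume TYPE('d) N)" for r N
  define e where "e r = surface_cost TYPE('d) \<beta> * (1 - box_volume TYPE('d) r / box_volume TYPE('d) (Suc r))" for r
  show ?thesis
  proof (rule convergent_of_almost_monotone[where C = "site_cost TYPE('d) \<beta>" and e = e and \<rho> = \<rho> and c = "surface_cost TYPE('d) \<beta>"])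
    show "0 \<le> box_relent n / box_volume TYPE('d) n" for n
      using relent_nonneg[of "lattice_box n"] box_volume_pos[of n, where 'd = 'd] by simp
    show "box_relent n / box_volume TYPE('d) n \<le> site_cost TYPE('d) \<beta>" for n
      using relent_le_card[of "lattice_box n"] box_volume_pos[of n, where 'd = 'd]
      by (simp add: divide_le_eq mult.commute card_lattice_box_eq_volume)
    have "(\<lambda>r. box_volume TYPE('d) r / box_volume TYPE('d) (Suc r)) \<longlonglongrightarrow> 1"
      using LIMSEQ_Suc[OF lattice_box_ratio_tendsto[of 1]] by simp
    then have "e \<longlonglongrightarrow> surface_cost TYPE('d) \<beta> * (1 - 1)"
      unfolding e_def by (intro tendsto_intros)
    then show "e \<longlonglongrightarrow> 0" by simp
  next
    fix r
    let ?n = "Suc r"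
    let ?L = "2 * ?n + 1"
    have M: "(N - ?n) div ?L * ?L + ?n \<le> N" "N - ?L \<le> (N - ?n) div ?L * ?L + ?n" if "N \<ge> ?n" for N
    proof -
      have "(N - ?n) div ?L * ?L + (N - ?n) mod ?L = N - ?n" by (rule div_mult_mod_eq)
      moreover have "(N - ?n) mod ?L < ?L" by (rule mod_less_divisor) simp
      ultimately show "(N - ?n) div ?L * ?L + ?n \<le> N" "N - ?L \<le> (N - ?n) div ?L * ?L + ?n"
        using that by linarith+
    qed
    show "\<rho> r \<longlonglongrightarrow> 1"
    proof (rule tendsto_sandwich)
      show "\<forall>\<^sub>F N in sequentially. box_volume TYPE('d) (N - ?L) / box_volume TYPE('d) N \<le> \<rho> r N"
        using eventually_ge_at_top[of ?n]
        unfolding \<rho>_def Let_def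
        by eventually_elim (intro divide_right_mono box_volume_mono M(2) less_imp_le[OF box_volume_pos])
      show "\<forall>\<^sub>F N in sequentially. \<rho> r N \<le> 1"
        using eventually_ge_at_top[of ?n]
        unfolding \<rho>_def Let_def
        by eventually_elim (intro divide_le_eq_1_pos[THEN iffD2] box_volume_pos box_volume_mono M(1))
    qed (auto intro: lattice_box_ratio_tendsto)
    show "\<forall>\<^sub>F N in sequentially. \<rho> r N * (box_relent (Suc r) / box_volume TYPE('d) (Suc r) - e r) - surface_cost TYPE('d) \<beta> * (1 - \<rho> r N)
        \<le> box_relent N / box_volume TYPE('d) N"
      using eventually_ge_at_top[of ?n]
    proof eventually_elim
      case (elim N)
      define k where "k = (N - ?n) div ?L"
      have \<rho>: "\<rho> r N = box_volume TYPE('d) k * box_volume TYPE('d) ?n / box_volume TYPE('d) N"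
        by (simp only: \<rho>_def Let_def k_def box_volume_mult)
      have le: "box_volume TYPE('d) k * (box_relent ?n - surface_cost TYPE('d) \<beta> * (box_volume TYPE('d) ?n - box_volume TYPE('d) r)) - surface_cost TYPE('d) \<beta> * (box_volume TYPE('d) N - box_volume TYPE('d) k * box_volume TYPE('d) ?n)
          \<le> box_relent N"
        using box_relent_ge[of k r N] M(1)[OF elim] unfolding box_volume_mult k_def by simp
      have "\<rho> r N * (box_relent ?n / box_volume TYPE('d) ?n - e r) - surface_cost TYPE('d) \<beta> * (1 - \<rho> r N)
          = (box_volume TYPE('d) k * (box_relent ?n - surface_cost TYPE('d) \<beta> * (box_volume TYPE('d) ?n - box_volume TYPE('d) r)) - surface_cost TYPE('d) \<beta> * (box_volume TYPE('d) N - box_volume TYPE('d) k * box_volume TYPE('d) ?n)) / box_volume TYPE('d) N"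
        unfolding \<rho> e_def using box_volume_pos[of ?n, where 'd = 'd] box_volume_pos[of N, where 'd = 'd] by (simp add: divide_simps)
      also have "\<dots> \<le> box_relent N / box_volume TYPE('d) N"
        using le by (intro divide_right_mono less_imp_le[OF box_volume_pos])
      finally show ?case .
    qed
  qed
qed

lemma rel_entropy_density_le:
  assumes s: "entropy_production \<beta> \<mu> = ereal s"
  shows "rel_entropy_density \<mu> \<nu> \<le> ereal ((1 - box_volume TYPE('d) r / box_volume TYPE('d) (Suc r)) * site_cost TYPE('d) \<beta>
    + tile_cost TYPE('d) \<beta> ((2 * r + 1) ^ CARD('d)) / box_volume TYPE('d) (Suc r) * s)"
proof -
  let ?n = "Suc r"
  let ?B = "(1 - box_volume TYPE('d) r / box_volume TYPE('d) ?n) * site_cost TYPE('d) \<beta>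
    + tile_cost TYPE('d) \<beta> ((2 * r + 1) ^ CARD('d)) / box_volume TYPE('d) ?n * s"
  obtain h where h: "(\<lambda>n. box_relent n / box_volume TYPE('d) n) \<longlonglongrightarrow> h"
    using box_relent_density_convergent by (auto simp: convergent_def)
  have eq: "rel_entropy (marginal (lattice_box n) \<mu>) (marginal (lattice_box n) \<nu>) / ereal (box_volume TYPE('d) n)
      = ereal (box_relent n / box_volume TYPE('d) n)" for n
    using box_volume_pos[of n, where 'd = 'd] by (simp add: rel_entropy_marginal)
  have "(\<lambda>n. ereal (box_relent n / box_volume TYPE('d) n)) \<longlonglongrightarrow> ereal h" using h by simp
  then have "rel_entropy_density \<mu> \<nu> = ereal h"
    unfolding rel_entropy_density_def card_lattice_box_eq_volume eq by (rule limI)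
  moreover have "h \<le> ?B"
  proof (rule LIMSEQ_le_const2)
    show "(\<lambda>k. box_relent (k * (2 * ?n + 1) + ?n) / box_volume TYPE('d) (k * (2 * ?n + 1) + ?n)) \<longlonglongrightarrow> h"
      by (rule LIMSEQ_subseq_LIMSEQ[OF h, of "\<lambda>k. k * (2 * ?n + 1) + ?n", unfolded o_def])
        (intro strict_monoI add_strict_right_mono mult_strict_right_mono; simp)
    have "box_relent (k * (2 * ?n + 1) + ?n) / box_volume TYPE('d) (k * (2 * ?n + 1) + ?n) \<le> ?B" for k
    proof -
      define a where "a = 1 - box_volume TYPE('d) r / box_volume TYPE('d) ?n"
      define b where "b = tile_cost TYPE('d) \<beta> ((2 * r + 1) ^ CARD('d)) / box_volume TYPE('d) ?n"
      have ab: "box_volume TYPE('d) ?n - box_volume TYPE('d) r = a * box_volume TYPE('d) ?n"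
          "tile_cost TYPE('d) \<beta> ((2 * r + 1) ^ CARD('d)) = b * box_volume TYPE('d) ?n"
        using box_volume_pos[of ?n, where 'd = 'd] by (simp_all add: a_def b_def field_simps)
      have "box_relent (k * (2 * ?n + 1) + ?n)
          \<le> (a * site_cost TYPE('d) \<beta> + b * s) * (box_volume TYPE('d) k * box_volume TYPE('d) ?n)"
        using box_relent_le[OF s, of k r] unfolding ab by (simp add: algebra_simps)
      then have "box_relent (k * (2 * ?n + 1) + ?n) \<le> ?B * (box_volume TYPE('d) k * box_volume TYPE('d) ?n)"
        unfolding a_def b_def .
      then show ?thesis
        unfolding box_volume_mult using box_volume_pos[of k, where 'd = 'd] box_volume_pos[of ?n, where 'd = 'd] by (simp add: divide_le_eq)
    qed
    then show "\<exists>N. \<forall>k\<ge>N. box_relent (k * (2 * ?n + 1) + ?n) / box_volume TYPE('d) (k * (2 * ?n + 1) + ?n) \<le> ?B" by blast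
  qed
  ultimately show ?thesis by simp
qed

end

lemma entropy_production_cases:
  "entropy_production \<beta> \<mu> = \<infinity> \<or> (\<exists>s. entropy_production \<beta> \<mu> = ereal s)"
  unfolding entropy_production_def rel_entropy_def Let_def by simp

theorem theorem2p1:
  fixes \<beta> \<epsilon> :: real
  assumes "\<beta> > 0" and "\<epsilon> > 0"
  shows "\<exists>\<delta>>0. \<forall>\<mu> \<in> (tinv_measures :: ('d::finite) config measure set). \<forall>\<nu> \<in> tinv_gibbs \<beta>.
           entropy_production \<beta> \<mu> \<ge> ereal \<delta> * (rel_entropy_density \<mu> \<nu> - ereal \<epsilon>)"
proof -
  have "(\<lambda>r. box_volume TYPE('d) r / box_volume TYPE('d) (Suc r)) \<longlonglongrightarrow> 1"
    using LIMSEQ_Suc[OF lattice_box_ratio_tendsto[of 1]] by simp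
  then have "(\<lambda>r. (1 - box_volume TYPE('d) r / box_volume TYPE('d) (Suc r)) * site_cost TYPE('d) \<beta>) \<longlonglongrightarrow> (1 - 1) * site_cost TYPE('d) \<beta>"
    by (intro tendsto_intros)
  then have "\<forall>\<^sub>F r in sequentially. (1 - box_volume TYPE('d) r / box_volume TYPE('d) (Suc r)) * site_cost TYPE('d) \<beta> < \<epsilon>"
    using assms(2) by (intro order_tendstoD(2)) auto
  then obtain r where r: "(1 - box_volume TYPE('d) r / box_volume TYPE('d) (Suc r)) * site_cost TYPE('d) \<beta> < \<epsilon>"
    by (auto simp: eventually_sequentially)
  \<comment> \<open>\<open>r\<close> is the radius at which the corridors around boxes of that radius cost less than \<open>\<epsilon>\<close> per site.\<close>
  define K where "K = tile_cost TYPE('d) \<beta> ((2 * r + 1) ^ CARD('d)) / box_volume TYPE('d) (Suc r)"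
  have K: "K > 0"
    using weight_bound_pos[of \<beta> "(2 * r + 1) ^ CARD('d)", where 'd = 'd]
    by (simp add: K_def tile_cost_def rate_bound_def box_volume_pos)
  have "ereal (1 / K) * (rel_entropy_density \<mu> \<nu> - ereal \<epsilon>) \<le> entropy_production \<beta> \<mu>"
    if \<mu>: "\<mu> \<in> (tinv_measures :: 'd config measure set)" and \<nu>: "\<nu> \<in> tinv_gibbs \<beta>" for \<mu> \<nu>
  proof -
    interpret tinv_gibbs_pair \<mu> \<nu> \<beta>
      using \<mu> \<nu> assms(1) tinv_measures_spin_law[OF \<mu>]
      by (simp add: tinv_gibbs_pair_def gibbs_pair_def gibbs_pair_axioms_def tinv_gibbs_pair_axioms_def tinv_gibbs_def)
    consider "entropy_production \<beta> \<mu> = \<infinity>" | s where "entropy_production \<beta> \<mu> = ereal s"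
      using entropy_production_cases by blast
    then show ?thesis
    proof cases
      case (2 s)
      have "rel_entropy_density \<mu> \<nu> \<le> ereal ((1 - box_volume TYPE('d) r / box_volume TYPE('d) (Suc r)) * site_cost TYPE('d) \<beta> + K * s)"
        using rel_entropy_density_le[OF 2, of r] by (simp add: K_def)
      also have "\<dots> \<le> ereal (\<epsilon> + K * s)" using r by simp
      finally have "rel_entropy_density \<mu> \<nu> - ereal \<epsilon> \<le> ereal (K * s)"
        by (cases "rel_entropy_density \<mu> \<nu>") auto
      then have "ereal (1 / K) * (rel_entropy_density \<mu> \<nu> - ereal \<epsilon>) \<le> ereal (1 / K) * ereal (K * s)"
        using K by (intro ereal_mult_left_mono) auto
      then show ?thesis using K 2 by simp
    qed simp
  qed
  then show ?thesis using K by (intro exI[of _ "1 / K"]) auto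
qed

end
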